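(* Let $a>0$ and $s$ be real numbers, let $g_a$ be the Hawking Taub-NUT metric on $\mathbf{R}^4$, and let $U_s$ be the vector field on $\mathbf{R}^4$ given by $$U_s=s\left(x^3\frac{\partial}{\partial x^1}+x^4\frac{\partial}{\partial x^2}-x^1\frac{\partial}{\partial x^3}-x^2\frac{\partial}{\partial x^4}\right).$$ Set $\widetilde{\Omega}_{a,s}=\{x\in\mathbf{R}^4 : \|U_s\|_{g_a}<1\}$. Let $F=\alpha+\beta$ be the Randers metric given by the navigation representation $(g_a,U_s)$. Then $F$ is an Einstein metric with non-constant flag curvature on $\widetilde{\Omega}_{a,s}$.
   Context: Let $x=(x^1,x^2,x^3,x^4)$ denote the standard coordinates on $\mathbf{R}^4$ (superscripts are indices) and $|x|$ the Euclidean norm. For $a>0$, the Hawking Taub-NUT metric on $\mathbf{R}^4$ is the Riemannian metric $$g_a=(a|x|^2+1)\,g_0-\frac{a(a|x|^2+2)}{a|x|^2+1}\,\omega^2,$$ where $g_0=\sum_{i=1}^4 (dx^i)^2$ and $\omega=-x^2dx^1+x^1dx^2-x^4dx^3+x^3dx^4$ (here $\omega^2=\omega\otimes\omega$). A Randers metric on a manifold $M$ is a Finsler metric of the form $F=\alpha+\beta$, where $\alpha=\sqrt{a_{ij}(x)y^iy^j}$ is a Riemannian metric and $\beta=b_i(x)y^i$ is a 1-form. Given a Riemannian metric $g=(g_{ij})$ and a vector field $V=V^i\frac{\partial}{\partial x^i}$, put $V_i=g_{ij}V^j$ and $\|V\|_g=\sqrt{V_iV^i}$. A pair $(g,V)$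 with $\|V\|_g<1$ is the (Zermelo) navigation representation of the Randers metric $F=\alpha+\beta$ if $$a_{ij}=\frac{g_{ij}}{1-\|V\|_g^2}+\frac{V_iV_j}{(1-\|V\|_g^2)^2},\qquad b_i=-\frac{V_i}{1-\|V\|_g^2}.$$ For a Finsler metric $F$ on an $n$-manifold $M$, let $g_y$ be the fundamental tensor, with components $g_{ij}(x,y)=\frac12[F^2]_{y^iy^j}$ and inverse $(g^{ij})$. The spray coefficients are $G^i=\frac14 g^{il}\left([F^2]_{x^ky^l}y^k-[F^2]_{x^l}\right)$, and the Riemann tensor $\mathbf{R}_y(u)=R^i_{\ k}(x,y)u^k\frac{\partial}{\partial x^i}$ has coefficients $$R^i_{\ k}=2\frac{\partial G^i}{\partial x^k}-y^j\frac{\partial^2G^i}{\partial x^j\partial y^k}+2G^j\frac{\partial^2G^i}{\partial y^j\partial y^k}-\frac{\partial G^i}{\partial y^j}\frac{\partial G^j}{\partial y^k}.$$ For a tangent plane $P=\mathrm{span}(y,u)$ with flag pole $y\neq 0$, the flag curvature is $$K(P,y)=\frac{g_y(\mathbf{R}_y(u),u)}{g_y(y,y)g_y(u,u)-g_y(y,u)^2}.$$ $F$ is of constant flag curvature if there is a constant $\lambda$ with $K(P,y)=\lambda$ for every nonzero tangent vector $y$ and every tangent plane $P$ containing $y$; $F$ has non-constant flag curvature if it is not of constant flag curvature. The Ricci curvature is $Ric(x,y)=R^i_{\ i}(x,y)$, and $F$ is an Einstein metric if there is a scalar function $K=K(x)$ on $M$ with $Ric=(n-1)KF^2$. *)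

theory Defs
  imports "HOL-Analysis.Analysis"
begin

section \<open>Finsler geometry on open subsets of \<open>\<real>\<^sup>n\<close>\<close>

text \<open>
  A function on the tangent bundle of an open set \<open>M\<close> in \<open>\<real>\<^sup>n\<close> is a curried function of a base
  point \<open>x\<close> and a tangent vector \<open>y\<close>, both given by their standard coordinates.
\<close>

definition pd_x :: "'n::finite \<Rightarrow> (real^'n \<Rightarrow> real^'n \<Rightarrow> real) \<Rightarrow> real^'n \<Rightarrow> real^'n \<Rightarrow> real"
  where "pd_x k H x y = deriv (\<lambda>t. H (x + t *\<^sub>R axis k 1) y) 0"

definition pd_y :: "'n::finite \<Rightarrow> (real^'n \<Rightarrow> real^'n \<Rightarrow> real) \<Rightarrow> real^'n \<Rightarrow> real^'n \<Rightarrow> real"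
  where "pd_y k H x y = deriv (\<lambda>t. H x (y + t *\<^sub>R axis k 1)) 0"

text \<open>The classes \<open>C\<^sup>k\<close> and \<open>C\<^sup>\<infinity>\<close>; both are meant for open sets \<open>S\<close> only.\<close>

primrec Ck_on :: "nat \<Rightarrow> ('a::euclidean_space \<Rightarrow> real) \<Rightarrow> 'a set \<Rightarrow> bool"
  where
    "Ck_on 0 f S \<longleftrightarrow> continuous_on S f"
  | "Ck_on (Suc k) f S \<longleftrightarrow>
       (\<forall>x\<in>S. f differentiable (at x)) \<and>
       (\<forall>v\<in>Basis. Ck_on k (\<lambda>x. frechet_derivative f (at x) v) S)"

definition smooth_on :: "('a::euclidean_space \<Rightarrow> real) \<Rightarrow> 'a set \<Rightarrow> bool"
  where "smooth_on f S \<longleftrightarrow> (\<forall>k. Ck_on k f S)"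

definition fundamental_tensor :: "(real^'n::finite \<Rightarrow> real^'n \<Rightarrow> real) \<Rightarrow> real^'n \<Rightarrow> real^'n \<Rightarrow> real^'n^'n"
  where "fundamental_tensor F x y =
    (\<chi> i j. 1/2 * pd_y j (pd_y i (\<lambda>x y. (F x y)\<^sup>2)) x y)"

definition finsler_metric_on :: "(real^'n::finite) set \<Rightarrow> (real^'n \<Rightarrow> real^'n \<Rightarrow> real) \<Rightarrow> bool"
  where "finsler_metric_on M F \<longleftrightarrow>
    open M \<and>
    smooth_on (\<lambda>(x, y). F x y) (M \<times> (- {0})) \<and>
    (\<forall>x\<in>M. \<forall>y. \<forall>c\<ge>0. F x (c *\<^sub>R y) = c * F x y) \<and>
    (\<forall>x\<in>M. \<forall>y. y \<noteq> 0 \<longrightarrow> F x y > 0) \<and>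
    (\<forall>x\<in>M. \<forall>y. y \<noteq> 0 \<longrightarrow>
       (\<forall>u. u \<noteq> 0 \<longrightarrow> u \<bullet> (fundamental_tensor F x y *v u) > 0))"

definition spray :: "(real^'n::finite \<Rightarrow> real^'n \<Rightarrow> real) \<Rightarrow> 'n \<Rightarrow> real^'n \<Rightarrow> real^'n \<Rightarrow> real"
  where "spray F i x y =
    1/4 * (\<Sum>l\<in>UNIV. matrix_inv (fundamental_tensor F x y) $ i $ l *
      ((\<Sum>k\<in>UNIV. pd_y l (pd_x k (\<lambda>x y. (F x y)\<^sup>2)) x y * y $ k)
        - pd_x l (\<lambda>x y. (F x y)\<^sup>2) x y))"

text \<open>Row \<open>i\<close>, column \<open>k\<close> holds \<open>R\<^sup>i\<^sub>k\<close>, so that \<open>\<^bold>R\<^sub>y(u)\<close> is the matrix-vector product.\<close>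

definition riemann :: "(real^'n::finite \<Rightarrow> real^'n \<Rightarrow> real) \<Rightarrow> real^'n \<Rightarrow> real^'n \<Rightarrow> real^'n^'n"
  where "riemann F x y = (\<chi> i k.
      2 * pd_x k (spray F i) x y
    - (\<Sum>j\<in>UNIV. y $ j * pd_x j (pd_y k (spray F i)) x y)
    + 2 * (\<Sum>j\<in>UNIV. spray F j x y * pd_y j (pd_y k (spray F i)) x y)
    - (\<Sum>j\<in>UNIV. pd_y j (spray F i) x y * pd_y k (spray F j) x y))"

text \<open>The flag curvature of the flag with pole \<open>y\<close> and plane \<open>span {y, u}\<close>.\<close>

definition flag_curvature :: "(real^'n::finite \<Rightarrow> real^'n \<Rightarrow> real) \<Rightarrow> real^'n \<Rightarrow> real^'n \<Rightarrow> real^'n \<Rightarrow> real"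
  where "flag_curvature F x y u =
    (let g = (\<lambda>v w. v \<bullet> (fundamental_tensor F x y *v w))
     in g (riemann F x y *v u) u / (g y y * g u u - (g y u)\<^sup>2))"

definition constant_flag_curvature_on :: "(real^'n::finite) set \<Rightarrow> (real^'n \<Rightarrow> real^'n \<Rightarrow> real) \<Rightarrow> bool"
  where "constant_flag_curvature_on M F \<longleftrightarrow>
    (\<exists>c. \<forall>x\<in>M. \<forall>y u. y \<noteq> 0 \<and> u \<notin> span {y} \<longrightarrow> flag_curvature F x y u = c)"

definition ricci :: "(real^'n::finite \<Rightarrow> real^'n \<Rightarrow> real) \<Rightarrow> real^'n \<Rightarrow> real^'n \<Rightarrow> real"
  where "ricci F x y = trace (riemann F x y)"

definition einstein_metric_on :: "(real^'n::finite) set \<Rightarrow> (real^'n \<Rightarrow> real^'n \<Rightarrow> real) \<Rightarrow> bool"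
  where "einstein_metric_on M F \<longleftrightarrow>
    finsler_metric_on M F \<and>
    (\<exists>K :: real^'n \<Rightarrow> real. \<forall>x\<in>M. \<forall>y. y \<noteq> 0 \<longrightarrow>
       ricci F x y = (real CARD('n) - 1) * K x * (F x y)\<^sup>2)"


section \<open>Randers metrics and Zermelo navigation\<close>

text \<open>Here \<open>A\<close> is the matrix field \<open>(a\<^sub>i\<^sub>j)\<close> of \<open>\<alpha>\<close> and \<open>b\<close> the component vector \<open>(b\<^sub>i)\<close> of \<open>\<beta>\<close>.\<close>

definition randers :: "(real^'n::finite \<Rightarrow> real^'n^'n) \<Rightarrow> (real^'n \<Rightarrow> real^'n) \<Rightarrow> real^'n \<Rightarrow> real^'n \<Rightarrow> real"
  where "randers A b x y =
    sqrt (\<Sum>i\<in>UNIV. \<Sum>j\<in>UNIV. A x $ i $ j * y $ i * y $ j) + (\<Sum>i\<in>UNIV. b x $ i * y $ i)"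

definition lower :: "(real^'n::finite \<Rightarrow> real^'n^'n) \<Rightarrow> (real^'n \<Rightarrow> real^'n) \<Rightarrow> real^'n \<Rightarrow> real^'n"
  where "lower g V x = (\<chi> i. \<Sum>j\<in>UNIV. g x $ i $ j * V x $ j)"

definition field_norm :: "(real^'n::finite \<Rightarrow> real^'n^'n) \<Rightarrow> (real^'n \<Rightarrow> real^'n) \<Rightarrow> real^'n \<Rightarrow> real"
  where "field_norm g V x = sqrt (\<Sum>i\<in>UNIV. lower g V x $ i * V x $ i)"

definition nav_metric :: "(real^'n::finite \<Rightarrow> real^'n^'n) \<Rightarrow> (real^'n \<Rightarrow> real^'n) \<Rightarrow> real^'n \<Rightarrow> real^'n^'n"
  where "nav_metric g V x = (\<chi> i j.
      g x $ i $ j / (1 - (field_norm g V x)\<^sup>2)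
    + lower g V x $ i * lower g V x $ j / (1 - (field_norm g V x)\<^sup>2)\<^sup>2)"

definition nav_form :: "(real^'n::finite \<Rightarrow> real^'n^'n) \<Rightarrow> (real^'n \<Rightarrow> real^'n) \<Rightarrow> real^'n \<Rightarrow> real^'n"
  where "nav_form g V x = (\<chi> i. - (lower g V x $ i / (1 - (field_norm g V x)\<^sup>2)))"

text \<open>
  The Randers metric with navigation representation \<open>(g, V)\<close>; it is meaningful only where
  \<open>field_norm g V x < 1\<close>.
\<close>

definition nav_randers :: "(real^'n::finite \<Rightarrow> real^'n^'n) \<Rightarrow> (real^'n \<Rightarrow> real^'n) \<Rightarrow> real^'n \<Rightarrow> real^'n \<Rightarrow> real"
  where "nav_randers g V = randers (nav_metric g V) (nav_form g V)"


section \<open>The Hawking Taub-NUT metric\<close>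

text \<open>
  The numeral \<open>4\<close> of the index type \<open>4\<close> equals \<open>0\<close>, so the coordinates \<open>x $ 1, \<dots>, x $ 4\<close> are
  the four distinct ones.
\<close>

definition taub_nut_form :: "real^4 \<Rightarrow> real^4"
  where "taub_nut_form x = vector [- (x $ 2), x $ 1, - (x $ 4), x $ 3]"

definition taub_nut :: "real \<Rightarrow> real^4 \<Rightarrow> real^4^4"
  where "taub_nut a x = (\<chi> i j.
      (a * (norm x)\<^sup>2 + 1) * (if i = j then 1 else 0)
    - a * (a * (norm x)\<^sup>2 + 2) / (a * (norm x)\<^sup>2 + 1) * (taub_nut_form x $ i * taub_nut_form x $ j))"

definition rotation_field :: "real \<Rightarrow> real^4 \<Rightarrow> real^4"
  where "rotation_field s x = s *\<^sub>R vector [x $ 3, x $ 4, - (x $ 1), - (x $ 2)]"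

definition nav_domain :: "real \<Rightarrow> real \<Rightarrow> (real^4) set"
  where "nav_domain a s = {x. field_norm (taub_nut a) (rotation_field s) x < 1}"

lemma vector_4_nth [simp]:
  "(vector [w, x, y, z] :: 'a::zero^4) $ 1 = w"
  "(vector [w, x, y, z] :: 'a::zero^4) $ 2 = x"
  "(vector [w, x, y, z] :: 'a::zero^4) $ 3 = y"
  "(vector [w, x, y, z] :: 'a::zero^4) $ 4 = z"
  unfolding vector_def by simp_all

end

theory Submission
  imports Defs
begin

text \<open>
  The field \<open>U\<^sub>s\<close> is linear, \<open>x \<mapsto> A x\<close>, and Killing for \<open>g\<^sub>a\<close>. For navigation by a linear Killing field
  put \<open>v = y - F A x\<close>, so that \<open>g(v, v) = F\<^sup>2\<close>. If \<open>\<Gamma>\<close> are the Christoffel symbols of \<open>g\<close>, the spray of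
  \<open>F\<close> is \<open>\<Gamma>(v, v)/2 - F A y + F\<^sup>2 A\<^sup>2 x/2\<close>: the geodesics of \<open>F\<close> are those of \<open>g\<close> carried along by the
  flow of the field. Differentiating, and using that a Killing field is a Jacobi field along every
  geodesic, one finds \<open>\<^bold>R\<^sub>y(u) = R\<^sub>v(u - \<theta>(u) A x)\<close>, where \<open>\<theta> = \<partial>F/\<partial>y\<close> is proportional to \<open>g(v, \<cdot>)\<close> and
  \<open>R\<^sub>v\<close> is the Jacobi operator of \<open>g\<close>. Since \<open>g(v, R\<^sub>v w) = 0\<close>, the Ricci curvature of \<open>F\<close> at \<open>y\<close> is
  that of \<open>g\<close> at \<open>v\<close>.

  For Taub-NUT the Jacobi operator is \<open>R\<^sub>v w = - 2 a f\<^sup>-\<^sup>3 (g(v, v) w - g(v, w) v - 3 g(K v, w) K v)\<close> with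
  \<open>f = a \<bar>x\<bar>\<^sup>2 + 1\<close> and a \<open>g\<close>-orthogonal almost complex structure \<open>K\<close>; its trace vanishes. At the
  origin the wind vanishes, and \<open>F\<close> has there the flag curvatures \<open>4 a\<close> and \<open>- 2 a\<close>.
\<close>

section \<open>Smooth functions\<close>

lemma frechet_derivative_eqI:
  "(f has_derivative f') (at x) \<Longrightarrow> frechet_derivative f (at x) = f'"
  by (metis frechet_derivative_at)

text \<open>The derivative at a point depends only on the germ of the function, so on an open set it
  suffices that the functions agree there.\<close>

lemma Ck_on_cong:
  assumes "open S" "\<And>x. x \<in> S \<Longrightarrow> f x = g x" "Ck_on k f S"
  shows "Ck_on k g S"
  using assms(2,3)
proof (induction k arbitrary: f g)
  case 0
  then show ?case by (metis Ck_on.simps(1) continuous_on_cong)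
next
  case (Suc k)
  have d: "(g has_derivative frechet_derivative f (at x)) (at x)" if "x \<in> S" for x
    using Suc.prems that assms(1)
    by (intro has_derivative_transform_within_open[of f _ x UNIV S g])
       (auto simp: frechet_derivative_works)
  show ?case
    unfolding Ck_on.simps
  proof (intro conjI ballI)
    fix v :: 'a assume v: "v \<in> Basis"
    show "Ck_on k (\<lambda>x. frechet_derivative g (at x) v) S"
    proof (rule Suc.IH)
      show "Ck_on k (\<lambda>x. frechet_derivative f (at x) v) S"
        using Suc.prems(2) v by simp
    qed (simp add: frechet_derivative_eqI[OF d])
  qed (use d differentiable_def in blast)
qed

text \<open>Admits an explicit derivative \<open>f'\<close> in place of
  \<open>frechet_derivative\<close>, so that the closure properties below become inductions on
  \<open>k\<close> driven by the differentiation rules.\<close>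

lemma Ck_on_SucI:
  assumes "open S" "\<And>x. x \<in> S \<Longrightarrow> (f has_derivative f' x) (at x)"
    and "\<And>v. v \<in> Basis \<Longrightarrow> Ck_on k (\<lambda>x. f' x v) S"
  shows "Ck_on (Suc k) f S"
  unfolding Ck_on.simps
proof (intro conjI ballI)
  fix v :: 'a assume v: "v \<in> Basis"
  show "Ck_on k (\<lambda>x. frechet_derivative f (at x) v) S"
    by (rule Ck_on_cong[OF assms(1) _ assms(3)[OF v]])
       (simp add: frechet_derivative_eqI[OF assms(2)])
qed (use assms(2) differentiable_def in blast)

lemma Ck_on_has_derivative:
  "Ck_on (Suc k) f S \<Longrightarrow> x \<in> S \<Longrightarrow> (f has_derivative frechet_derivative f (at x)) (at x)"
  by (simp add: frechet_derivative_works)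

lemma Ck_on_Suc_imp: "Ck_on (Suc k) f S \<Longrightarrow> Ck_on k f S"
proof (induction k arbitrary: f)
  case 0
  then show ?case
    by (auto intro!: continuous_at_imp_continuous_on differentiable_imp_continuous_within)
next
  case (Suc k)
  then show ?case by (metis Ck_on.simps(2))
qed

lemma Ck_on_const: "open S \<Longrightarrow> Ck_on k (\<lambda>x. c) S"
proof (induction k arbitrary: c)
  case (Suc k)
  then show ?case by (intro Ck_on_SucI[where f' = "\<lambda>x v. 0"]) auto
qed simp

lemma Ck_on_linear: "open S \<Longrightarrow> bounded_linear f \<Longrightarrow> Ck_on k f S"
proof (induction k)
  case 0
  then show ?case by (simp add: linear_continuous_on)
next
  case (Suc k)
  then show ?case
    by (intro Ck_on_SucI[where f' = "\<lambda>x. f"])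
       (auto simp: bounded_linear_imp_has_derivative Ck_on_const)
qed

lemma Ck_on_add:
  "open S \<Longrightarrow> Ck_on k f S \<Longrightarrow> Ck_on k g S \<Longrightarrow> Ck_on k (\<lambda>x. f x + g x) S"
proof (induction k arbitrary: f g)
  case 0
  then show ?case by (simp add: continuous_on_add)
next
  case (Suc k)
  show ?case
  proof (rule Ck_on_SucI[OF Suc.prems(1)])
    show "((\<lambda>x. f x + g x) has_derivative
      (\<lambda>v. frechet_derivative f (at x) v + frechet_derivative g (at x) v)) (at x)"
      if "x \<in> S" for x
      using Suc.prems that by (intro has_derivative_add Ck_on_has_derivative)
  qed (use Suc in simp)
qed

lemma Ck_on_mult:
  "open S \<Longrightarrow> Ck_on k f S \<Longrightarrow> Ck_on k g S \<Longrightarrow> Ck_on k (\<lambda>x. f x * g x) S"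
proof (induction k arbitrary: f g)
  case 0
  then show ?case by (simp add: continuous_on_mult)
next
  case (Suc k)
  show ?case
  proof (rule Ck_on_SucI[OF Suc.prems(1)])
    show "((\<lambda>x. f x * g x) has_derivative
      (\<lambda>v. f x * frechet_derivative g (at x) v + frechet_derivative f (at x) v * g x)) (at x)"
      if "x \<in> S" for x
      using Suc.prems that by (intro has_derivative_mult Ck_on_has_derivative)
    show "Ck_on k (\<lambda>x. f x * frechet_derivative g (at x) v + frechet_derivative f (at x) v * g x) S"
      if "v \<in> Basis" for v
      using Suc.prems that by (intro Ck_on_add Suc.IH) (auto intro: Ck_on_Suc_imp)
  qed
qed

lemma Ck_on_inverse:
  "open S \<Longrightarrow> Ck_on k f S \<Longrightarrow> (\<And>x. x \<in> S \<Longrightarrow> f x \<noteq> 0) \<Longrightarrow> Ck_on k (\<lambda>x. inverse (f x)) S"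
proof (induction k)
  case 0
  then show ?case by (simp add: continuous_on_inverse)
next
  case (Suc k)
  show ?case
  proof (rule Ck_on_SucI[OF Suc.prems(1)])
    show "((\<lambda>x. inverse (f x)) has_derivative
      (\<lambda>v. - (inverse (f x) * frechet_derivative f (at x) v * inverse (f x)))) (at x)"
      if "x \<in> S" for x
      using Suc.prems that by (intro Deriv.has_derivative_inverse Ck_on_has_derivative) auto
    have inv: "Ck_on k (\<lambda>x. inverse (f x)) S"
      using Suc.prems by (intro Suc.IH) (auto intro: Ck_on_Suc_imp)
    have "Ck_on k (\<lambda>x. (- 1) * (inverse (f x) * frechet_derivative f (at x) v * inverse (f x))) S"
      if "v \<in> Basis" for v
      using Suc.prems that inv by (intro Ck_on_mult Ck_on_const) auto
    then show "Ck_on k (\<lambda>x. - (inverse (f x) * frechet_derivative f (at x) v * inverse (f x))) S"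
      if "v \<in> Basis" for v
      using that by simp
  qed
qed

lemma Ck_on_sqrt:
  "open S \<Longrightarrow> Ck_on k f S \<Longrightarrow> (\<And>x. x \<in> S \<Longrightarrow> f x > 0) \<Longrightarrow> Ck_on k (\<lambda>x. sqrt (f x)) S"
proof (induction k)
  case 0
  then show ?case by (simp add: continuous_on_real_sqrt)
next
  case (Suc k)
  show ?case
  proof (rule Ck_on_SucI[OF Suc.prems(1)])
    show "((\<lambda>x. sqrt (f x)) has_derivative
      (\<lambda>v. frechet_derivative f (at x) v * (inverse (sqrt (f x)) * (1 / 2)))) (at x)"
      if "x \<in> S" for x
      using Suc.prems(3)[OF that]
      by (auto intro!: derivative_eq_intros Ck_on_has_derivative[OF Suc.prems(2) that]
          simp: field_simps)
    have "Ck_on k (\<lambda>x. inverse (sqrt (f x))) S"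
    proof (rule Ck_on_inverse[OF Suc.prems(1)])
      show "Ck_on k (\<lambda>x. sqrt (f x)) S"
        using Suc.prems by (intro Suc.IH) (auto intro: Ck_on_Suc_imp)
    qed (use Suc.prems in force)
    then show "Ck_on k (\<lambda>x. frechet_derivative f (at x) v * (inverse (sqrt (f x)) * (1 / 2))) S"
      if "v \<in> Basis" for v
      using Suc.prems that by (intro Ck_on_mult Ck_on_const) auto
  qed
qed

lemma smooth_on_const: "open S \<Longrightarrow> smooth_on (\<lambda>x. c) S"
  by (simp add: smooth_on_def Ck_on_const)

lemma smooth_on_linear: "open S \<Longrightarrow> bounded_linear f \<Longrightarrow> smooth_on f S"
  by (simp add: smooth_on_def Ck_on_linear)

lemma smooth_on_add:
  "open S \<Longrightarrow> smooth_on f S \<Longrightarrow> smooth_on g S \<Longrightarrow> smooth_on (\<lambda>x. f x + g x) S"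
  by (simp add: smooth_on_def Ck_on_add)

lemma smooth_on_mult:
  "open S \<Longrightarrow> smooth_on f S \<Longrightarrow> smooth_on g S \<Longrightarrow> smooth_on (\<lambda>x. f x * g x) S"
  by (simp add: smooth_on_def Ck_on_mult)

lemma smooth_on_diff:
  assumes "open S" "smooth_on f S" "smooth_on g S"
  shows "smooth_on (\<lambda>x. f x - g x) S"
  using smooth_on_add[OF assms(1,2) smooth_on_mult[OF assms(1) smooth_on_const[OF assms(1), of "- 1"] assms(3)]]
  by simp

lemma smooth_on_power: "open S \<Longrightarrow> smooth_on f S \<Longrightarrow> smooth_on (\<lambda>x. f x ^ n) S"
  by (induction n) (simp_all add: smooth_on_const smooth_on_mult)

lemma smooth_on_sum:
  "open S \<Longrightarrow> (\<And>i. i \<in> I \<Longrightarrow> smooth_on (f i) S) \<Longrightarrow> smooth_on (\<lambda>x. \<Sum>i\<in>I. f i x) S"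
  by (induction I rule: infinite_finite_induct) (simp_all add: smooth_on_const smooth_on_add)

lemma smooth_on_divide:
  assumes "open S" "smooth_on f S" "smooth_on g S" "\<And>x. x \<in> S \<Longrightarrow> g x \<noteq> 0"
  shows "smooth_on (\<lambda>x. f x / g x) S"
  unfolding divide_inverse using assms
  by (intro smooth_on_mult) (auto simp: smooth_on_def intro: Ck_on_inverse)

lemma smooth_on_sqrt:
  "open S \<Longrightarrow> smooth_on f S \<Longrightarrow> (\<And>x. x \<in> S \<Longrightarrow> f x > 0) \<Longrightarrow> smooth_on (\<lambda>x. sqrt (f x)) S"
  by (simp add: smooth_on_def Ck_on_sqrt)

lemma smooth_on_inner_linear:
  fixes P Q :: "'a::euclidean_space \<Rightarrow> 'b::euclidean_space"
  assumes "open S" "bounded_linear P" "bounded_linear Q"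
  shows "smooth_on (\<lambda>x. P x \<bullet> Q x) S"
proof -
  have "smooth_on (\<lambda>x. \<Sum>b\<in>Basis. (P x \<bullet> b) * (Q x \<bullet> b)) S"
    using assms
    by (intro smooth_on_sum smooth_on_mult smooth_on_linear)
       (auto intro: bounded_linear_compose[OF bounded_linear_inner_left])
  then show ?thesis by (simp add: euclidean_inner[symmetric])
qed

lemma smooth_on_cong:
  assumes "open S" "\<And>x. x \<in> S \<Longrightarrow> f x = g x" "smooth_on f S"
  shows "smooth_on g S"
  using assms Ck_on_cong unfolding smooth_on_def by blast


section \<open>Navigation by a linear Killing field\<close>

lemma bilinear_eq_sum_Basis:
  fixes B :: "'a::euclidean_space \<Rightarrow> 'b::euclidean_space \<Rightarrow> 'c::real_vector"
  assumes "bilinear B"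
  shows "B v w = (\<Sum>i\<in>Basis. \<Sum>j\<in>Basis. ((v \<bullet> i) * (w \<bullet> j)) *\<^sub>R B i j)"
proof -
  have l: "linear (\<lambda>v. B v w)" and r: "\<And>u. linear (B u)" for w
    using assms by (auto simp: bilinear_def)
  have "B v w = B (\<Sum>i\<in>Basis. (v \<bullet> i) *\<^sub>R i) (\<Sum>j\<in>Basis. (w \<bullet> j) *\<^sub>R j)"
    by (simp add: euclidean_representation)
  then show ?thesis
    by (simp add: linear_sum[OF l] linear_sum[OF r] bilinear_lmul[OF assms] bilinear_rmul[OF assms]
        scaleR_sum_right mult.commute) (rule sum.swap)
qed

text \<open>In finite dimension, differentiability in \<open>z\<close> for each fixed pair of
  arguments is enough: the basis expansion leaves finite sums of products of differentiable
  functions.\<close>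

lemma has_derivative_bilinear_family:
  fixes B :: "'z::real_normed_vector \<Rightarrow> 'a::euclidean_space \<Rightarrow> 'b::euclidean_space \<Rightarrow> 'c::real_normed_vector"
  assumes bil: "\<And>z. bilinear (B z)" "\<And>d. bilinear (B' d)"
    and B: "\<And>v w. ((\<lambda>z. B z v w) has_derivative (\<lambda>d. B' d v w)) (at z)"
    and V: "(V has_derivative V') (at z)" and W: "(W has_derivative W') (at z)"
  shows "((\<lambda>z. B z (V z) (W z)) has_derivative
    (\<lambda>d. B' d (V z) (W z) + B z (V' d) (W z) + B z (V z) (W' d))) (at z)"
proof -
  have "((\<lambda>z. \<Sum>i\<in>Basis. \<Sum>j\<in>Basis. ((V z \<bullet> i) * (W z \<bullet> j)) *\<^sub>R B z i j) has_derivative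
     (\<lambda>d. \<Sum>i\<in>Basis. \<Sum>j\<in>Basis. ((V z \<bullet> i) * (W z \<bullet> j)) *\<^sub>R B' d i j
        + ((V z \<bullet> i) * (W' d \<bullet> j) + (V' d \<bullet> i) * (W z \<bullet> j)) *\<^sub>R B z i j)) (at z)"
    by (intro has_derivative_sum has_derivative_scaleR has_derivative_mult has_derivative_inner_left
        B V W)
  moreover have "B z (V z) (W z) = (\<Sum>i\<in>Basis. \<Sum>j\<in>Basis. ((V z \<bullet> i) * (W z \<bullet> j)) *\<^sub>R B z i j)" for z
    by (rule bilinear_eq_sum_Basis[OF bil(1)])
  moreover have "B' d (V z) (W z) + B z (V' d) (W z) + B z (V z) (W' d)
     = (\<Sum>i\<in>Basis. \<Sum>j\<in>Basis. ((V z \<bullet> i) * (W z \<bullet> j)) *\<^sub>R B' d i j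
        + ((V z \<bullet> i) * (W' d \<bullet> j) + (V' d \<bullet> i) * (W z \<bullet> j)) *\<^sub>R B z i j)" for d
    unfolding bilinear_eq_sum_Basis[OF bil(2), of d "V z" "W z"]
      bilinear_eq_sum_Basis[OF bil(1), of z "V' d" "W z"]
      bilinear_eq_sum_Basis[OF bil(1), of z "V z" "W' d"]
    by (simp add: sum.distrib scaleR_add_left)
  ultimately show ?thesis by simp
qed

text \<open>Lets \<open>pd_x\<close> and \<open>pd_y\<close> be read off a total derivative on the
  product space.\<close>

lemma deriv_along_line:
  assumes "(f has_derivative f') (at p)"
  shows "deriv (\<lambda>t. f (p + t *\<^sub>R d)) 0 = f' d"
proof -
  have "((\<lambda>t::real. p + t *\<^sub>R d) has_derivative (\<lambda>t. t *\<^sub>R d)) (at 0)"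
    by (auto intro!: derivative_eq_intros)
  from has_derivative_compose[OF this, of f f'] assms
  have "((\<lambda>t. f (p + t *\<^sub>R d)) has_derivative (\<lambda>t. f' (t *\<^sub>R d))) (at 0)"
    by simp
  moreover have "(\<lambda>t. f' (t *\<^sub>R d)) = (*) (f' d)"
    using linear_scale[OF has_derivative_linear[OF assms]] by (auto simp: mult.commute)
  ultimately show ?thesis
    by (metis DERIV_imp_deriv has_field_derivative_def)
qed

lemma pd_x_eq:
  assumes "((\<lambda>z. H (fst z) (snd z)) has_derivative H') (at (x, y))"
  shows "pd_x k H x y = H' (axis k 1, 0)"
  using deriv_along_line[OF assms, of "(axis k 1, 0)"] by (simp add: pd_x_def)

lemma pd_y_eq:
  assumes "((\<lambda>z. H (fst z) (snd z)) has_derivative H') (at (x, y))"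
  shows "pd_y k H x y = H' (0, axis k 1)"
  using deriv_along_line[OF assms, of "(0, axis k 1)"] by (simp add: pd_y_def)

text \<open>Turns the coordinate sums of the Finsler definitions back into coordinate-free
  expressions.\<close>

lemma linear_sum_axis:
  fixes f :: "real^'n::finite \<Rightarrow> 'b::real_vector"
  assumes "linear f"
  shows "(\<Sum>i\<in>UNIV. (v $ i) *\<^sub>R f (axis i 1)) = f v"
proof -
  have "f v = f (\<Sum>i\<in>UNIV. (v $ i) *\<^sub>R axis i 1)"
    using basis_expansion[of v] by (simp add: scalar_mult_eq_scaleR)
  then show ?thesis by (simp add: linear_sum[OF assms] linear_scale[OF assms])
qed

lemma nav_randers_eq:
  fixes G :: "real^'n::finite \<Rightarrow> real^'n^'n"
  assumes sym: "\<And>v w. v \<bullet> (G x *v w) = w \<bullet> (G x *v v)"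
    and pos: "V x \<bullet> (G x *v V x) \<ge> 0" and less: "V x \<bullet> (G x *v V x) < 1"
  defines "m \<equiv> 1 - V x \<bullet> (G x *v V x)"
  shows "nav_randers G V x y
    = (sqrt (m * (y \<bullet> (G x *v y)) + (y \<bullet> (G x *v V x))\<^sup>2) - y \<bullet> (G x *v V x)) / m"
proof -
  have lower: "lower G V x = G x *v V x"
    by (simp add: lower_def matrix_vector_mult_def)
  have fn: "(field_norm G V x)\<^sup>2 = V x \<bullet> (G x *v V x)"
    using pos by (simp add: field_norm_def lower inner_vec_def mult.commute)
  have m: "m > 0" using less by (simp add: m_def)
  have "(\<Sum>i\<in>UNIV. \<Sum>j\<in>UNIV. nav_metric G V x $ i $ j * y $ i * y $ j)
     = (\<Sum>i\<in>UNIV. \<Sum>j\<in>UNIV. G x $ i $ j * y $ i * y $ j) / m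
       + (\<Sum>i\<in>UNIV. (G x *v V x) $ i * y $ i) * (\<Sum>i\<in>UNIV. (G x *v V x) $ i * y $ i) / m\<^sup>2"
    by (simp add: nav_metric_def fn lower sum_product sum_divide_distrib sum.distrib
        m_def[symmetric] algebra_simps add_divide_distrib)
  also have "(\<Sum>i\<in>UNIV. \<Sum>j\<in>UNIV. G x $ i $ j * y $ i * y $ j) = y \<bullet> (G x *v y)"
    by (simp add: inner_vec_def matrix_vector_mult_def sum_distrib_left algebra_simps)
  also have "(\<Sum>i\<in>UNIV. (G x *v V x) $ i * y $ i) = y \<bullet> (G x *v V x)"
    by (simp add: inner_vec_def mult.commute)
  finally have a: "(\<Sum>i\<in>UNIV. \<Sum>j\<in>UNIV. nav_metric G V x $ i $ j * y $ i * y $ j)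
     = (m * (y \<bullet> (G x *v y)) + (y \<bullet> (G x *v V x))\<^sup>2) / m\<^sup>2"
    using m by (simp add: field_simps power2_eq_square)
  have "(\<Sum>i\<in>UNIV. nav_form G V x $ i * y $ i) = - (\<Sum>i\<in>UNIV. (G x *v V x) $ i * y $ i) / m"
    by (simp add: nav_form_def fn lower m_def[symmetric] sum_divide_distrib sum_negf)
  then have b: "(\<Sum>i\<in>UNIV. nav_form G V x $ i * y $ i) = - (y \<bullet> (G x *v V x)) / m"
    by (simp add: inner_vec_def mult.commute)
  show ?thesis
    using m unfolding nav_randers_def randers_def a b
    by (simp add: real_sqrt_divide diff_divide_distrib)
qed

text \<open>Positivity makes the kernel trivial, so \<open>M\<close> is invertible and the choice in
  \<open>matrix_inv\<close> yields a genuine inverse.\<close>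

lemma matrix_inv_mult_vector:
  fixes M :: "real^'n::finite^'n"
  assumes "\<And>u. u \<noteq> 0 \<Longrightarrow> u \<bullet> (M *v u) > 0"
  shows "matrix_inv M *v (M *v u) = u"
proof -
  have "\<exists>B. B ** M = mat 1"
    unfolding matrix_left_invertible_ker using assms by (metis inner_zero_right less_irrefl)
  then have "\<exists>B. M ** B = mat 1 \<and> B ** M = mat 1"
    using invertible_left_inverse invertible_def by blast
  then have "matrix_inv M ** M = mat 1"
    unfolding matrix_inv_def by (metis (mono_tags, lifting) someI_ex)
  then show ?thesis
    by (simp add: matrix_vector_mul_assoc)
qed

text \<open>
  \<open>dG x \<xi>\<close> and \<open>d\<Gamma> x \<xi>\<close> are the derivatives at \<open>x\<close> along \<open>\<xi>\<close> of the metric and of its Christoffel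
  symbols \<open>\<Gamma>\<close>; the equations \<open>killing\<close> and \<open>affine\<close> say that the Lie derivatives of both along the
  linear field \<open>A\<close> vanish.
\<close>

locale killing_navigation =
  fixes G :: "real^'n::finite \<Rightarrow> real^'n^'n"
    and dG :: "real^'n \<Rightarrow> real^'n \<Rightarrow> real^'n \<Rightarrow> real^'n \<Rightarrow> real"
    and \<Gamma> :: "real^'n \<Rightarrow> real^'n \<Rightarrow> real^'n \<Rightarrow> real^'n"
    and d\<Gamma> :: "real^'n \<Rightarrow> real^'n \<Rightarrow> real^'n \<Rightarrow> real^'n \<Rightarrow> real^'n"
    and A :: "real^'n \<Rightarrow> real^'n"
    and F :: "real^'n \<Rightarrow> real^'n \<Rightarrow> real"
  assumes G_sym: "\<And>x v w. v \<bullet> (G x *v w) = w \<bullet> (G x *v v)"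
    and G_pos: "\<And>x v. v \<noteq> 0 \<Longrightarrow> v \<bullet> (G x *v v) > 0"
    and G_deriv: "\<And>x v w. ((\<lambda>x. v \<bullet> (G x *v w)) has_derivative (\<lambda>\<xi>. dG x \<xi> v w)) (at x)"
    and dG_bilinear: "\<And>x \<xi>. bilinear (dG x \<xi>)"
    and \<Gamma>_bilinear: "\<And>x. bilinear (\<Gamma> x)"
    and \<Gamma>_sym: "\<And>x v w. \<Gamma> x v w = \<Gamma> x w v"
    and \<Gamma>_deriv: "\<And>x v w. ((\<lambda>x. \<Gamma> x v w) has_derivative (\<lambda>\<xi>. d\<Gamma> x \<xi> v w)) (at x)"
    and d\<Gamma>_bilinear: "\<And>x \<xi>. bilinear (d\<Gamma> x \<xi>)"
    and compatible: "\<And>x \<xi> v w. dG x \<xi> v w = \<Gamma> x \<xi> v \<bullet> (G x *v w) + v \<bullet> (G x *v \<Gamma> x \<xi> w)"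
    and A_linear: "linear A"
    and killing: "\<And>x v w. dG x (A x) v w + A v \<bullet> (G x *v w) + v \<bullet> (G x *v A w) = 0"
    and affine: "\<And>x v w. d\<Gamma> x (A x) v w = A (\<Gamma> x v w) - \<Gamma> x (A v) w - \<Gamma> x v (A w)"
    and F_def: "F = nav_randers G A"
begin

definition g :: "real^'n \<Rightarrow> real^'n \<Rightarrow> real^'n \<Rightarrow> real"
  where "g x v w = v \<bullet> (G x *v w)"

definition M :: "(real^'n) set"
  where "M = {x. g x (A x) (A x) < 1}"

text \<open>
  \<open>vel x y\<close> is the velocity relative to the wind, of \<open>g\<close>-length \<open>F x y\<close>. The functionals \<open>\<theta> x y\<close> and
  \<open>dF x y\<close> are \<open>\<partial>F/\<partial>y\<close> and the total derivative of \<open>F\<close>, both read off from that equation, and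
  \<open>S x y\<close> and \<open>N x y\<close> are the spray coefficients of \<open>F\<close> and their derivative in \<open>y\<close>.
\<close>

definition vel :: "real^'n \<Rightarrow> real^'n \<Rightarrow> real^'n"
  where "vel x y = y - F x y *\<^sub>R A x"

text \<open>The coefficient of dF when g(vel, vel) = F^2 is differentiated; by \<open>lam_eq\<close>
  it is the square root in the formula for \<open>F\<close>.\<close>

definition lam :: "real^'n \<Rightarrow> real^'n \<Rightarrow> real"
  where "lam x y = F x y + g x (vel x y) (A x)"

definition \<theta> :: "real^'n \<Rightarrow> real^'n \<Rightarrow> real^'n \<Rightarrow> real"
  where "\<theta> x y \<eta> = g x (vel x y) \<eta> / lam x y"

definition dF :: "real^'n \<Rightarrow> real^'n \<Rightarrow> (real^'n) \<times> (real^'n) \<Rightarrow> real"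
  where "dF x y d = (1/2 * dG x (fst d) (vel x y) (vel x y) - F x y * g x (vel x y) (A (fst d))
    + g x (vel x y) (snd d)) / lam x y"

definition dvel :: "real^'n \<Rightarrow> real^'n \<Rightarrow> (real^'n) \<times> (real^'n) \<Rightarrow> real^'n"
  where "dvel x y d = snd d - dF x y d *\<^sub>R A x - F x y *\<^sub>R A (fst d)"

definition dlam :: "real^'n \<Rightarrow> real^'n \<Rightarrow> (real^'n) \<times> (real^'n) \<Rightarrow> real"
  where "dlam x y d = dF x y d + dG x (fst d) (vel x y) (A x) + g x (dvel x y d) (A x)
    + g x (vel x y) (A (fst d))"

definition d\<theta> :: "real^'n \<Rightarrow> real^'n \<Rightarrow> (real^'n) \<times> (real^'n) \<Rightarrow> real^'n \<Rightarrow> real"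
  where "d\<theta> x y d \<eta> = (dG x (fst d) (vel x y) \<eta> + g x (dvel x y d) \<eta> - \<theta> x y \<eta> * dlam x y d) / lam x y"

definition S :: "real^'n \<Rightarrow> real^'n \<Rightarrow> real^'n"
  where "S x y = (1/2) *\<^sub>R \<Gamma> x (vel x y) (vel x y) - F x y *\<^sub>R A y + ((F x y)\<^sup>2 / 2) *\<^sub>R A (A x)"

definition dS :: "real^'n \<Rightarrow> real^'n \<Rightarrow> (real^'n) \<times> (real^'n) \<Rightarrow> real^'n"
  where "dS x y d = (1/2) *\<^sub>R d\<Gamma> x (fst d) (vel x y) (vel x y) + \<Gamma> x (vel x y) (dvel x y d)
    - dF x y d *\<^sub>R A y - F x y *\<^sub>R A (snd d)
    + (F x y * dF x y d) *\<^sub>R A (A x) + ((F x y)\<^sup>2 / 2) *\<^sub>R A (A (fst d))"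

text \<open>The covariant derivative of the field \<open>A\<close> in the direction
  \<open>vel x y\<close>.\<close>

definition q :: "real^'n \<Rightarrow> real^'n \<Rightarrow> real^'n"
  where "q x y = \<Gamma> x (vel x y) (A x) + A (vel x y)"

definition N :: "real^'n \<Rightarrow> real^'n \<Rightarrow> real^'n \<Rightarrow> real^'n"
  where "N x y w = \<Gamma> x (vel x y) w - F x y *\<^sub>R A w - \<theta> x y w *\<^sub>R q x y"

definition dq :: "real^'n \<Rightarrow> real^'n \<Rightarrow> (real^'n) \<times> (real^'n) \<Rightarrow> real^'n"
  where "dq x y d = d\<Gamma> x (fst d) (vel x y) (A x) + \<Gamma> x (dvel x y d) (A x)
    + \<Gamma> x (vel x y) (A (fst d)) + A (dvel x y d)"

definition dN :: "real^'n \<Rightarrow> real^'n \<Rightarrow> (real^'n) \<times> (real^'n) \<Rightarrow> real^'n \<Rightarrow> real^'n"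
  where "dN x y d w = d\<Gamma> x (fst d) (vel x y) w + \<Gamma> x (dvel x y d) w - dF x y d *\<^sub>R A w
    - d\<theta> x y d w *\<^sub>R q x y - \<theta> x y w *\<^sub>R dq x y d"

text \<open>The Jacobi operator w \<mapsto> R(w, v)v of the symmetric connection \<Gamma>.\<close>

definition jacobi :: "real^'n \<Rightarrow> real^'n \<Rightarrow> real^'n \<Rightarrow> real^'n"
  where "jacobi x v w = d\<Gamma> x w v v - d\<Gamma> x v v w + \<Gamma> x (\<Gamma> x v v) w - \<Gamma> x v (\<Gamma> x v w)"

lemma g_bilinear: "bilinear (g x)"
  unfolding bilinear_def g_def
  by (auto intro!: linearI simp: inner_left_distrib inner_right_distrib matrix_vector_right_distrib
      matrix_vector_mult_scaleR)

lemmas bilin_simps =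
  bilinear_ladd[OF g_bilinear] bilinear_radd[OF g_bilinear] bilinear_lmul[OF g_bilinear]
  bilinear_rmul[OF g_bilinear] bilinear_lsub[OF g_bilinear] bilinear_rsub[OF g_bilinear]
  bilinear_lneg[OF g_bilinear] bilinear_rneg[OF g_bilinear]
  bilinear_lzero[OF g_bilinear] bilinear_rzero[OF g_bilinear]
  bilinear_ladd[OF \<Gamma>_bilinear] bilinear_radd[OF \<Gamma>_bilinear] bilinear_lmul[OF \<Gamma>_bilinear]
  bilinear_rmul[OF \<Gamma>_bilinear] bilinear_lsub[OF \<Gamma>_bilinear] bilinear_rsub[OF \<Gamma>_bilinear]
  bilinear_lneg[OF \<Gamma>_bilinear] bilinear_rneg[OF \<Gamma>_bilinear]
  bilinear_lzero[OF \<Gamma>_bilinear] bilinear_rzero[OF \<Gamma>_bilinear]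
  linear_add[OF A_linear] linear_diff[OF A_linear] linear_scale[OF A_linear]
  linear_neg[OF A_linear] linear_0[OF A_linear]

lemma dG_linear: "linear (\<lambda>\<xi>. dG x \<xi> v w)"
  using has_derivative_linear[OF G_deriv] .

lemma d\<Gamma>_linear: "linear (\<lambda>\<xi>. d\<Gamma> x \<xi> v w)"
  using has_derivative_linear[OF \<Gamma>_deriv] .

lemmas dlin_simps =
  linear_add[OF dG_linear] linear_diff[OF dG_linear] linear_scale[OF dG_linear] linear_0[OF dG_linear]
  linear_add[OF d\<Gamma>_linear] linear_diff[OF d\<Gamma>_linear] linear_scale[OF d\<Gamma>_linear] linear_0[OF d\<Gamma>_linear]

lemma g_sym: "g x v w = g x w v"
  unfolding g_def by (rule G_sym)

lemma g_pos: "v \<noteq> 0 \<Longrightarrow> g x v v > 0"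
  unfolding g_def by (rule G_pos)

lemma g_nonneg: "g x v v \<ge> 0"
  using g_pos[of v x] by (cases "v = 0") (auto simp: bilin_simps)

lemma g_Cauchy_Schwarz: "(g x v w)\<^sup>2 \<le> g x v v * g x w w"
proof (cases "w = 0")
  case False
  have "0 \<le> g x (g x w w *\<^sub>R v - g x v w *\<^sub>R w) (g x w w *\<^sub>R v - g x v w *\<^sub>R w)"
    by (rule g_nonneg)
  also have "\<dots> = g x w w * (g x v v * g x w w - (g x v w)\<^sup>2)"
    by (simp add: bilin_simps g_sym[of x w v] power2_eq_square algebra_simps)
  finally show ?thesis
    using g_pos[OF False, of x] by (simp add: zero_le_mult_iff)
qed (simp add: bilin_simps)

lemma dG_eq: "dG x \<xi> v w = g x (\<Gamma> x \<xi> v) w + g x v (\<Gamma> x \<xi> w)"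
  by (simp add: g_def compatible)

lemma killing_g: "dG x (A x) v w = - g x (A v) w - g x v (A w)"
  using killing[of x v w] by (simp add: g_def)

lemma A_has_derivative: "(X has_derivative X') (at z) \<Longrightarrow> ((\<lambda>z. A (X z)) has_derivative (\<lambda>d. A (X' d))) (at z)"
  using A_linear linear_conv_bounded_linear bounded_linear.has_derivative by blast

lemma g_has_derivative:
  assumes X: "(X has_derivative X') (at z)" and V: "(V has_derivative V') (at z)"
    and W: "(W has_derivative W') (at z)"
  shows "((\<lambda>z. g (X z) (V z) (W z)) has_derivative
    (\<lambda>d. dG (X z) (X' d) (V z) (W z) + g (X z) (V' d) (W z) + g (X z) (V z) (W' d))) (at z)"
proof (rule has_derivative_bilinear_family[OF g_bilinear dG_bilinear _ V W])
  show "((\<lambda>z. g (X z) v w) has_derivative (\<lambda>d. dG (X z) (X' d) v w)) (at z)" for v w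
    using has_derivative_compose[OF X G_deriv] unfolding g_def .
qed

lemma \<Gamma>_has_derivative:
  assumes X: "(X has_derivative X') (at z)" and V: "(V has_derivative V') (at z)"
    and W: "(W has_derivative W') (at z)"
  shows "((\<lambda>z. \<Gamma> (X z) (V z) (W z)) has_derivative
    (\<lambda>d. d\<Gamma> (X z) (X' d) (V z) (W z) + \<Gamma> (X z) (V' d) (W z) + \<Gamma> (X z) (V z) (W' d))) (at z)"
  by (rule has_derivative_bilinear_family[OF \<Gamma>_bilinear d\<Gamma>_bilinear _ V W])
     (rule has_derivative_compose[OF X \<Gamma>_deriv])

lemma open_M: "open M"
proof -
  have "continuous_on UNIV (\<lambda>x. g x (A x) (A x))"
    by (intro continuous_at_imp_continuous_on ballI has_derivative_continuous)
       (rule g_has_derivative[OF _ A_has_derivative A_has_derivative]; rule has_derivative_ident)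
  then show ?thesis
    unfolding M_def by (intro open_Collect_less) (auto intro: continuous_intros)
qed

lemma open_M_times: "open (M \<times> (- {0 :: real^'n}))"
  by (intro open_Times open_M) auto

section \<open>The Zermelo equation and the derivative of F\<close>

lemma F_eq:
  assumes "x \<in> M"
  shows "F x y = (sqrt ((1 - g x (A x) (A x)) * g x y y + (g x y (A x))\<^sup>2) - g x y (A x))
    / (1 - g x (A x) (A x))"
  unfolding F_def g_def
  by (rule nav_randers_eq) (use assms G_sym g_nonneg in \<open>auto simp: M_def g_def\<close>)

lemma radicand_pos:
  assumes "x \<in> M" "y \<noteq> 0"
  shows "(1 - g x (A x) (A x)) * g x y y + (g x y (A x))\<^sup>2 > 0"
  using assms g_pos[of y x] by (intro add_pos_nonneg) (auto simp: M_def)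

lemma lam_eq:
  assumes "x \<in> M"
  shows "lam x y = sqrt ((1 - g x (A x) (A x)) * g x y y + (g x y (A x))\<^sup>2)"
proof -
  have "lam x y = (1 - g x (A x) (A x)) * F x y + g x y (A x)"
    by (simp add: lam_def vel_def bilin_simps algebra_simps)
  then show ?thesis
    using assms by (simp add: F_eq M_def)
qed

lemma lam_pos: "x \<in> M \<Longrightarrow> y \<noteq> 0 \<Longrightarrow> lam x y > 0"
  using radicand_pos by (simp add: lam_eq)

lemma F_pos:
  assumes "x \<in> M" "y \<noteq> 0"
  shows "F x y > 0"
proof -
  have "\<bar>g x y (A x)\<bar> < sqrt ((1 - g x (A x) (A x)) * g x y y + (g x y (A x))\<^sup>2)"
    using assms g_pos[of y x] by (intro real_less_rsqrt) (auto simp: M_def)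
  then show ?thesis
    using assms by (simp add: F_eq M_def)
qed

lemma F_homogeneous:
  assumes "x \<in> M" "c \<ge> 0"
  shows "F x (c *\<^sub>R y) = c * F x y"
proof -
  have "sqrt ((1 - g x (A x) (A x)) * g x (c *\<^sub>R y) (c *\<^sub>R y) + (g x (c *\<^sub>R y) (A x))\<^sup>2)
     = sqrt (c\<^sup>2 * ((1 - g x (A x) (A x)) * g x y y + (g x y (A x))\<^sup>2))"
    by (simp add: bilin_simps algebra_simps power2_eq_square)
  also have "\<dots> = c * sqrt ((1 - g x (A x) (A x)) * g x y y + (g x y (A x))\<^sup>2)"
    using assms by (simp add: real_sqrt_mult)
  finally show ?thesis
    using assms by (simp add: F_eq bilin_simps field_simps)
qed

text \<open>\<open>F x y\<close> is a root of m t^2 + 2 g(y, A x) t = g(y, y), where m = 1 - g(A x,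
  A x). Completing the square, \<open>lam x y\<close> = m t + g(y, A x) squares to the radicand;
  cancelling m > 0 gives the claim.\<close>

lemma zermelo:
  assumes "x \<in> M" "y \<noteq> 0"
  shows "g x (vel x y) (vel x y) = (F x y)\<^sup>2"
proof -
  have "(lam x y)\<^sup>2 = (1 - g x (A x) (A x)) * g x y y + (g x y (A x))\<^sup>2"
    using radicand_pos[OF assms] by (simp add: lam_eq[OF assms(1)])
  moreover have "lam x y = (1 - g x (A x) (A x)) * F x y + g x y (A x)"
    by (simp add: lam_def vel_def bilin_simps algebra_simps)
  ultimately have "(1 - g x (A x) (A x)) *
      (g x y y - 2 * F x y * g x y (A x) - (1 - g x (A x) (A x)) * (F x y)\<^sup>2) = 0"
    by (simp add: power2_eq_square algebra_simps)
  then have "g x y y - 2 * F x y * g x y (A x) - (1 - g x (A x) (A x)) * (F x y)\<^sup>2 = 0"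
    using assms(1) by (simp add: M_def)
  then show ?thesis
    by (simp add: vel_def bilin_simps g_sym[of x "A x" y] power2_eq_square algebra_simps)
qed

text \<open>The root formula only provides some derivative \<open>D\<close>. Differentiating both
  sides of \<open>zermelo\<close>, uniqueness of derivatives gives an equation linear in
  \<open>D\<close> with leading coefficient \<open>lam x y\<close>, whose solution is the short form
  \<open>dF\<close>.\<close>

lemma F_has_derivative:
  assumes "x \<in> M" "y \<noteq> 0"
  shows "((\<lambda>z. F (fst z) (snd z)) has_derivative dF x y) (at (x, y))"
proof -
  let ?Q = "\<lambda>z. (1 - g (fst z) (A (fst z)) (A (fst z))) * g (fst z) (snd z) (snd z)
      + (g (fst z) (snd z) (A (fst z)))\<^sup>2"
  let ?E = "\<lambda>z. (sqrt (?Q z) - g (fst z) (snd z) (A (fst z)))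
      / (1 - g (fst z) (A (fst z)) (A (fst z)))"
  have fst: "(fst has_derivative fst) (at (x, y))" and snd: "(snd has_derivative snd) (at (x, y))"
    by (auto intro!: derivative_eq_intros)
  note AA = A_has_derivative[OF fst]
  note d = g_has_derivative[OF fst AA AA] g_has_derivative[OF fst snd snd]
    g_has_derivative[OF fst snd AA]
  have "1 - g x (A x) (A x) \<noteq> 0"
    using assms by (simp add: M_def)
  then have "\<exists>D. (?E has_derivative D) (at (x, y))"
    using radicand_pos[OF assms]
    by (intro exI) (rule derivative_intros d | simp)+
  then obtain D where "(?E has_derivative D) (at (x, y))" ..
  then have D: "((\<lambda>z. F (fst z) (snd z)) has_derivative D) (at (x, y))"
    by (rule has_derivative_transform_within_open[OF _ open_M_times])
       (use assms in \<open>auto simp: F_eq\<close>)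
  let ?V = "\<lambda>d. snd d - (D d *\<^sub>R A x + F x y *\<^sub>R A (fst d))"
  have V: "((\<lambda>z. vel (fst z) (snd z)) has_derivative ?V) (at (x, y))"
    unfolding vel_def by (auto intro!: derivative_eq_intros D AA simp: add.commute)
  have sq: "g (fst z) (vel (fst z) (snd z)) (vel (fst z) (snd z)) = (F (fst z) (snd z))\<^sup>2"
    if "z \<in> M \<times> (- {0})" for z
    using that by (intro zermelo) auto
  have "((\<lambda>z. (F (fst z) (snd z))\<^sup>2) has_derivative
      (\<lambda>d. dG x (fst d) (vel x y) (vel x y) + g x (?V d) (vel x y) + g x (vel x y) (?V d)))
    (at (x, y))"
    using g_has_derivative[OF fst V V] unfolding fst_conv snd_conv
    by (rule has_derivative_transform_within_open[OF _ open_M_times])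
       (use assms sq in auto)
  moreover have "((\<lambda>z. (F (fst z) (snd z))\<^sup>2) has_derivative (\<lambda>d. 2 * F x y * D d)) (at (x, y))"
    by (auto intro!: derivative_eq_intros D)
  ultimately have eq: "dG x (fst d) (vel x y) (vel x y) + g x (?V d) (vel x y) + g x (vel x y) (?V d)
      = 2 * F x y * D d" for d
    by (rule fun_cong[OF has_derivative_unique])
  have "D d * lam x y = 1/2 * dG x (fst d) (vel x y) (vel x y) - F x y * g x (vel x y) (A (fst d))
      + g x (vel x y) (snd d)" for d
    using eq[of d] unfolding g_sym[of x "?V d" "vel x y"]
    by (simp add: lam_def bilin_simps algebra_simps)
  then have "D = dF x y"
    using lam_pos[OF assms] by (auto simp: dF_def field_simps)
  then show ?thesis using D by simp
qed

lemma dF_linear: "x \<in> M \<Longrightarrow> y \<noteq> 0 \<Longrightarrow> linear (dF x y)"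
  using has_derivative_linear[OF F_has_derivative] .

lemma dF_y: "dF x y (0, w) = \<theta> x y w"
  by (simp add: dF_def \<theta>_def dlin_simps bilin_simps)

lemma \<theta>_linear: "linear (\<theta> x y)"
  unfolding \<theta>_def by (auto intro!: linearI simp: bilin_simps add_divide_distrib)

section \<open>First derivatives, in all directions and along the spray\<close>

context
  fixes x y :: "real^'n"
  assumes xy: "x \<in> M" "y \<noteq> 0"
begin

lemma fst_derivative: "(fst has_derivative fst) (at (x, y))"
  by (auto intro!: derivative_eq_intros)

lemma snd_derivative: "(snd has_derivative snd) (at (x, y))"
  by (auto intro!: derivative_eq_intros)

lemma vel_has_derivative: "((\<lambda>z. vel (fst z) (snd z)) has_derivative dvel x y) (at (x, y))"
  unfolding vel_def dvel_def
  by (auto intro!: derivative_eq_intros F_has_derivative[OF xy] A_has_derivative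
      simp: algebra_simps)

lemma lam_has_derivative: "((\<lambda>z. lam (fst z) (snd z)) has_derivative dlam x y) (at (x, y))"
  unfolding lam_def dlam_def
  by (auto intro!: derivative_eq_intros F_has_derivative[OF xy] A_has_derivative
      g_has_derivative vel_has_derivative simp: algebra_simps)

lemma \<theta>_has_derivative:
  assumes "(u has_derivative u') (at (x, y))"
  shows "((\<lambda>z. \<theta> (fst z) (snd z) (u z)) has_derivative
    (\<lambda>d. d\<theta> x y d (u (x, y)) + \<theta> x y (u' d))) (at (x, y))"
  unfolding \<theta>_def d\<theta>_def
  using lam_pos[OF xy]
  by (auto intro!: derivative_eq_intros g_has_derivative vel_has_derivative lam_has_derivative assms
      simp: bilin_simps field_simps)

lemma S_has_derivative: "((\<lambda>z. S (fst z) (snd z)) has_derivative dS x y) (at (x, y))"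
  unfolding S_def dS_def
  by (rule has_derivative_eq_rhs,
      rule derivative_intros F_has_derivative[OF xy] A_has_derivative \<Gamma>_has_derivative
        vel_has_derivative fst_derivative snd_derivative | simp)+
     (auto simp: fun_eq_iff algebra_simps \<Gamma>_sym[of x "dvel x y _"] scaleR_2 simp flip: scaleR_add_left)

lemma q_has_derivative: "((\<lambda>z. q (fst z) (snd z)) has_derivative dq x y) (at (x, y))"
  unfolding q_def dq_def
  by (auto intro!: derivative_eq_intros A_has_derivative \<Gamma>_has_derivative vel_has_derivative
      simp: algebra_simps)

lemma N_has_derivative: "((\<lambda>z. N (fst z) (snd z) w) has_derivative (\<lambda>d. dN x y d w)) (at (x, y))"
  unfolding N_def dN_def
  by (auto intro!: derivative_eq_intros F_has_derivative[OF xy] \<Gamma>_has_derivative vel_has_derivative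
      q_has_derivative \<theta>_has_derivative simp: bilin_simps linear_0[OF \<theta>_linear] algebra_simps)

lemma dvel_y: "dvel x y (0, w) = w - \<theta> x y w *\<^sub>R A x"
  by (simp add: dvel_def dF_y bilin_simps)

text \<open>As y = vel + F A x, all terms carrying \<open>\<theta> x y w\<close> combine into a
  multiple of \<open>q x y\<close>.\<close>

lemma dS_y: "dS x y (0, w) = N x y w"
  by (simp add: dS_def dvel_y dF_y N_def q_def vel_def bilin_simps dlin_simps power2_eq_square
      algebra_simps)

lemma dvel_x: "dvel x y (w, 0) = - (dF x y (w, 0) *\<^sub>R A x) - F x y *\<^sub>R A w"
  by (simp add: dvel_def)

lemma dS_x:
  "2 *\<^sub>R dS x y (w, 0) = d\<Gamma> x w (vel x y) (vel x y) - (2 * F x y) *\<^sub>R \<Gamma> x (vel x y) (A w)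
    - (2 * dF x y (w, 0)) *\<^sub>R q x y + (F x y)\<^sup>2 *\<^sub>R A (A w)"
proof -
  have y: "A y = A (vel x y) + F x y *\<^sub>R A (A x)"
    by (simp add: vel_def bilin_simps)
  show ?thesis
    unfolding dS_def y by (simp add: dvel_x q_def bilin_simps algebra_simps)
qed

text \<open>By the Killing equation the covariant derivative of \<open>A\<close> is skew for
  \<open>g\<close>, so its quadratic form vanishes.\<close>

lemma g_vel_q: "g x (vel x y) (q x y) = 0"
proof -
  have "g x (vel x y) (\<Gamma> x (vel x y) (A x)) = 1/2 * dG x (A x) (vel x y) (vel x y)"
    by (simp add: dG_eq \<Gamma>_sym[of x "A x"] g_sym[of x _ "vel x y"])
  then show ?thesis
    by (simp add: q_def bilin_simps killing_g g_sym[of x _ "vel x y"])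
qed

text \<open>The horizontal derivative of \<open>F\<close> vanishes.\<close>

lemma \<theta>_N: "\<theta> x y (N x y w) = dF x y (w, 0)"
  using g_vel_q
  by (simp add: \<theta>_def N_def dF_def bilin_simps dG_eq \<Gamma>_sym[of x w] g_sym[of x _ "vel x y"])

text \<open>The direction is the geodesic vector field with spray \<open>S\<close>, so
  \<open>F\<close> is constant along its integral curves. Once y = vel + F A x is inserted, what
  remains is a multiple of g(vel, q) = 0.\<close>

lemma dF_spray: "dF x y (y, - (2 *\<^sub>R S x y)) = 0"
proof -
  have "1/2 * dG x y (vel x y) (vel x y) = g x (vel x y) (\<Gamma> x (vel x y) y)"
    by (simp add: dG_eq \<Gamma>_sym[of x y] g_sym[of x _ "vel x y"])
  moreover have "y = vel x y + F x y *\<^sub>R A x"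
    by (simp add: vel_def)
  then have "g x (vel x y) (\<Gamma> x (vel x y) y) = g x (vel x y) (\<Gamma> x (vel x y) (vel x y + F x y *\<^sub>R A x))"
    and "A y = A (vel x y + F x y *\<^sub>R A x)"
    by simp_all
  ultimately show ?thesis
    using arg_cong[OF g_vel_q, of "(*) (F x y)"]
    by (simp add: dF_def S_def bilin_simps q_def power2_eq_square algebra_simps)
qed

text \<open>Along the spray the relative velocity obeys the geodesic equation of \<open>g\<close>,
  up to the term by which the flow of \<open>A\<close> carries it along.\<close>

lemma dvel_spray: "dvel x y (y, - (2 *\<^sub>R S x y)) = F x y *\<^sub>R A (vel x y) - \<Gamma> x (vel x y) (vel x y)"
  unfolding dvel_def dF_spray
  by (simp add: S_def vel_def bilin_simps power2_eq_square vec_eq_iff algebra_simps)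

text \<open>The base direction splits as y = vel + F A x, and the Killing equation evaluates the
  part along \<open>A x\<close>; \<open>d\<Gamma>_spray\<close> does the same with
  \<open>affine\<close>.\<close>

lemma dG_spray: "dG x y v w = dG x (vel x y) v w - F x y * (g x (A v) w + g x v (A w))"
proof -
  have "dG x y v w = dG x (vel x y + F x y *\<^sub>R A x) v w"
    by (simp add: vel_def)
  then show ?thesis
    by (simp add: dlin_simps killing_g algebra_simps)
qed

lemma d\<Gamma>_spray: "d\<Gamma> x y v w = d\<Gamma> x (vel x y) v w
    + F x y *\<^sub>R (A (\<Gamma> x v w) - \<Gamma> x (A v) w - \<Gamma> x v (A w))"
proof -
  have "d\<Gamma> x y v w = d\<Gamma> x (vel x y + F x y *\<^sub>R A x) v w"
    by (simp add: vel_def)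
  then show ?thesis
    by (simp add: dlin_simps affine)
qed

lemma d_momentum_spray:
  "dG x y (vel x y) w + g x (dvel x y (y, - (2 *\<^sub>R S x y))) w
    = g x (vel x y) (\<Gamma> x (vel x y) w) - F x y * g x (vel x y) (A w)"
  unfolding dG_spray dvel_spray by (simp add: bilin_simps dG_eq algebra_simps)

text \<open>Both summands of \<open>lam\<close> are conserved: \<open>F\<close> by
  \<open>dF_spray\<close>, and g(vel, A x) as the momentum of a Killing field.\<close>

lemma dlam_spray: "dlam x y (y, - (2 *\<^sub>R S x y)) = 0"
proof -
  have y: "A y = A (vel x y) + F x y *\<^sub>R A (A x)"
    by (simp add: vel_def bilin_simps)
  show ?thesis
    using d_momentum_spray[of "A x"] g_vel_q
    by (simp add: dlam_def dF_spray y q_def bilin_simps)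
qed

text \<open>The Euler-Lagrange equation of \<open>F\<close>: along the spray the derivative of
  \<theta> = dF/dy is dF/dx.\<close>

lemma d\<theta>_spray: "d\<theta> x y (y, - (2 *\<^sub>R S x y)) w = dF x y (w, 0)"
  unfolding d\<theta>_def fst_conv d_momentum_spray
  by (simp add: dlam_spray dF_def bilin_simps dG_eq \<Gamma>_sym[of x w] g_sym[of x _ "vel x y"])

text \<open>The Jacobi equation for \<open>A\<close>: the left side is the covariant derivative of
  \<open>q\<close> along \<open>vel\<close>, taken in the frame moving with the flow of
  \<open>A\<close>.\<close>

lemma dq_spray:
  "dq x y (y, - (2 *\<^sub>R S x y)) + \<Gamma> x (vel x y) (q x y) - F x y *\<^sub>R A (q x y) = - jacobi x (vel x y) (A x)"
proof -
  have y: "A y = A (vel x y) + F x y *\<^sub>R A (A x)"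
    by (simp add: vel_def bilin_simps)
  show ?thesis
    unfolding dq_def jacobi_def affine fst_conv d\<Gamma>_spray dvel_spray y q_def
    by (simp add: bilin_simps \<Gamma>_sym[of x "A (vel x y)" "vel x y"] algebra_simps)
qed

lemma N_linear: "linear (N x y)"
  unfolding N_def
  by (auto intro!: linearI simp: bilin_simps linear_add[OF \<theta>_linear] linear_scale[OF \<theta>_linear] algebra_simps)

text \<open>The Killing field \<open>A\<close> is a Jacobi field, which is why it enters only through \<open>jacobi\<close>.\<close>

lemma curvature_identity:
  "2 *\<^sub>R dS x y (w, 0) - dN x y (y, - (2 *\<^sub>R S x y)) w - N x y (N x y w)
    = jacobi x (vel x y) (w - \<theta> x y w *\<^sub>R A x)"
proof -
  have NN: "N x y (N x y w) = \<Gamma> x (vel x y) (\<Gamma> x (vel x y) w)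
      - F x y *\<^sub>R \<Gamma> x (vel x y) (A w) - F x y *\<^sub>R A (\<Gamma> x (vel x y) w) + (F x y)\<^sup>2 *\<^sub>R A (A w)
      - \<theta> x y w *\<^sub>R (\<Gamma> x (vel x y) (q x y) - F x y *\<^sub>R A (q x y)) - dF x y (w, 0) *\<^sub>R q x y"
    unfolding \<theta>_N[symmetric] N_def[of x y "N x y w"] unfolding N_def[of x y w]
    by (simp add: bilin_simps power2_eq_square algebra_simps)
  have DN: "dN x y (y, - (2 *\<^sub>R S x y)) w = d\<Gamma> x (vel x y) (vel x y) w
      + F x y *\<^sub>R (A (\<Gamma> x (vel x y) w) - \<Gamma> x (vel x y) (A w))
      - \<Gamma> x (\<Gamma> x (vel x y) (vel x y)) w
      - dF x y (w, 0) *\<^sub>R q x y - \<theta> x y w *\<^sub>R dq x y (y, - (2 *\<^sub>R S x y))"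
    unfolding dN_def fst_conv d\<Gamma>_spray dvel_spray d\<theta>_spray dF_spray
    by (simp add: bilin_simps algebra_simps)
  have j: "jacobi x (vel x y) (w - \<theta> x y w *\<^sub>R A x)
      = jacobi x (vel x y) w - \<theta> x y w *\<^sub>R jacobi x (vel x y) (A x)"
    by (simp add: jacobi_def bilin_simps dlin_simps bilinear_rsub[OF d\<Gamma>_bilinear]
        bilinear_rmul[OF d\<Gamma>_bilinear] algebra_simps)
  have q: "jacobi x (vel x y) (A x) =
      - (dq x y (y, - (2 *\<^sub>R S x y)) + \<Gamma> x (vel x y) (q x y) - F x y *\<^sub>R A (q x y))"
    by (simp add: dq_spray)
  \<comment> \<open>The terms in F, in F^2 and in \<open>dF x y (w, 0)\<close> cancel between
    \<open>dS_x\<close>, \<open>DN\<close> and \<open>NN\<close>; those in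
    \<open>\<theta> x y w\<close> are matched by \<open>q\<close>.\<close>
  show ?thesis
    unfolding NN DN j q dS_x unfolding jacobi_def
    by (simp add: vec_eq_iff algebra_simps)
qed

lemma F\<theta>_has_derivative:
  assumes "(u has_derivative u') (at (x, y))"
  shows "((\<lambda>z. F (fst z) (snd z) * \<theta> (fst z) (snd z) (u z)) has_derivative
    (\<lambda>d. dF x y d * \<theta> x y (u (x, y)) + F x y * (d\<theta> x y d (u (x, y)) + \<theta> x y (u' d)))) (at (x, y))"
  by (rule has_derivative_eq_rhs[OF has_derivative_mult[OF F_has_derivative[OF xy] \<theta>_has_derivative[OF assms]]])
     (simp add: algebra_simps)

end

section \<open>The fundamental tensor of F\<close>

definition fund :: "real^'n \<Rightarrow> real^'n \<Rightarrow> real^'n \<Rightarrow> real^'n \<Rightarrow> real"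
  where "fund x y \<eta> \<zeta> = F x y / lam x y * g x (\<eta> - \<theta> x y \<eta> *\<^sub>R A x) (\<zeta> - \<theta> x y \<zeta> *\<^sub>R A x)
    + \<theta> x y \<eta> * \<theta> x y \<zeta> * (1 - F x y / lam x y)"

lemma fund_sym: "fund x y \<eta> \<zeta> = fund x y \<zeta> \<eta>"
  by (simp add: fund_def g_sym[of x "\<eta> - _"])

lemma fund_bilinear: "bilinear (fund x y)"
  unfolding bilinear_def fund_def
  by (auto intro!: linearI
      simp: bilin_simps linear_add[OF \<theta>_linear] linear_scale[OF \<theta>_linear] algebra_simps add_divide_distrib)

context
  fixes x y :: "real^'n"
  assumes xy: "x \<in> M" "y \<noteq> 0"
begin

text \<open>Identifies \<open>fund\<close> with half the vertical Hessian of F^2, that is, the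
  vertical derivative of F \<theta>. The vectors \<eta> - \<theta>(\<eta>) A x in its definition are
  vertical derivatives of \<open>vel\<close>.\<close>

lemma fund_eq: "fund x y \<eta> \<zeta> = dF x y (0, \<zeta>) * \<theta> x y \<eta> + F x y * d\<theta> x y (0, \<zeta>) \<eta>"
  using lam_pos[OF xy]
  by (simp add: fund_def d\<theta>_def dlam_def dvel_y[OF xy] dF_y dlin_simps bilin_simps field_simps
      g_sym[of x \<zeta> \<eta>] g_sym[of x "A x" \<eta>] g_sym[of x "A x" \<zeta>])

text \<open>Since 1 - F/lam has no definite sign in general, the terms are regrouped around g(u',
  u') - \<theta>(u)^2. This is nonnegative by Cauchy-Schwarz, because g(vel, u') = F \<theta>(u) and
  g(vel, vel) = F^2. If \<theta>(u) = 0, then u' = u.\<close>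

lemma fund_pos:
  assumes "u \<noteq> 0"
  shows "fund x y u u > 0"
proof -
  define u' where "u' = u - \<theta> x y u *\<^sub>R A x"
  have F: "F x y > 0" and l: "lam x y > 0"
    using F_pos[OF xy] lam_pos[OF xy] by auto
  have "g x (vel x y) u = \<theta> x y u * lam x y"
    using l by (simp add: \<theta>_def)
  then have "g x (vel x y) u' = \<theta> x y u * F x y"
    by (simp add: u'_def bilin_simps lam_def algebra_simps)
  then have "(F x y)\<^sup>2 * (\<theta> x y u)\<^sup>2 \<le> (F x y)\<^sup>2 * g x u' u'"
    using g_Cauchy_Schwarz[of x "vel x y" u'] by (simp add: zermelo[OF xy] power_mult_distrib mult.commute)
  then have le: "(\<theta> x y u)\<^sup>2 \<le> g x u' u'"
    using F by simp
  have eq: "fund x y u u = F x y / lam x y * (g x u' u' - (\<theta> x y u)\<^sup>2) + (\<theta> x y u)\<^sup>2"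
    by (simp add: fund_def u'_def power2_eq_square algebra_simps)
  show ?thesis
  proof (cases "\<theta> x y u = 0")
    case True
    then show ?thesis
      unfolding eq using F l g_pos[OF assms, of x] by (simp add: u'_def)
  next
    case False
    then show ?thesis
      unfolding eq using F l le by (intro add_nonneg_pos mult_nonneg_nonneg) auto
  qed
qed

lemma pd_F_squared:
  "pd_x k (\<lambda>x y. (F x y)\<^sup>2) x y = 2 * (F x y * \<theta> x y (N x y (axis k 1)))"
  "pd_y k (\<lambda>x y. (F x y)\<^sup>2) x y = 2 * (F x y * \<theta> x y (axis k 1))"
proof -
  have "((\<lambda>z. (F (fst z) (snd z))\<^sup>2) has_derivative (\<lambda>d. 2 * (F x y * dF x y d))) (at (x, y))"
    by (auto intro!: derivative_eq_intros F_has_derivative[OF xy])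
  from pd_x_eq[OF this] pd_y_eq[OF this] show
    "pd_x k (\<lambda>x y. (F x y)\<^sup>2) x y = 2 * (F x y * \<theta> x y (N x y (axis k 1)))"
    "pd_y k (\<lambda>x y. (F x y)\<^sup>2) x y = 2 * (F x y * \<theta> x y (axis k 1))"
    by (simp_all add: \<theta>_N[OF xy] dF_y)
qed

end

section \<open>Second derivatives of F^2 and the spray coefficients\<close>

context
  fixes x y :: "real^'n"
  assumes xy: "x \<in> M" "y \<noteq> 0"
begin

text \<open>Identities valid at all points of this open set may be differentiated again.\<close>

lemma transform_M:
  assumes "(f has_derivative f') (at (x, y))" "\<And>x y. x \<in> M \<Longrightarrow> y \<noteq> 0 \<Longrightarrow> f (x, y) = h (x, y)"
  shows "(h has_derivative f') (at (x, y))"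
  by (rule has_derivative_transform_within_open[OF assms(1) open_M_times])
     (use xy assms(2) in auto)

lemma pd_y_pd_y:
  "pd_y j (pd_y i (\<lambda>x y. (F x y)\<^sup>2)) x y = 2 * fund x y (axis i 1) (axis j 1)"
proof -
  have "((\<lambda>z. 2 * (F (fst z) (snd z) * \<theta> (fst z) (snd z) (axis i 1))) has_derivative
    (\<lambda>d. 2 * (dF x y d * \<theta> x y (axis i 1) + F x y * (d\<theta> x y d (axis i 1) + \<theta> x y 0)))) (at (x, y))"
    by (intro has_derivative_mult_right F\<theta>_has_derivative[OF xy] has_derivative_const)
  then have "((\<lambda>z. pd_y i (\<lambda>x y. (F x y)\<^sup>2) (fst z) (snd z)) has_derivative
    (\<lambda>d. 2 * (dF x y d * \<theta> x y (axis i 1) + F x y * (d\<theta> x y d (axis i 1) + \<theta> x y 0)))) (at (x, y))"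
    by (rule transform_M) (simp add: pd_F_squared)
  from pd_y_eq[OF this] show ?thesis
    by (simp add: fund_eq[OF xy] linear_0[OF \<theta>_linear])
qed

lemma fundamental_tensor_mult:
  "u \<bullet> (fundamental_tensor F x y *v w) = fund x y u w"
proof -
  have M: "fundamental_tensor F x y $ i $ j = fund x y (axis i 1) (axis j 1)" for i j
    by (simp add: fundamental_tensor_def pd_y_pd_y)
  have l: "linear (\<lambda>u. fund x y u w)" and r: "linear (fund x y u)" for u w
    using fund_bilinear by (auto simp: bilinear_def)
  have "(fundamental_tensor F x y *v w) $ i = fund x y (axis i 1) w" for i
    using linear_sum_axis[OF r, of w "axis i 1"]
    by (simp add: matrix_vector_mult_def M mult.commute)
  then show ?thesis
    using linear_sum_axis[OF l, of u w] by (simp add: inner_vec_def)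
qed

text \<open>No mixed derivative is computed in closed form. The function y^k [F^2]_{x^k} equals 4 F
  \<theta>(S); differentiating both expressions along y^l gives y^k [F^2]_{x^k y^l} + [F^2]_{x^l} =
  4 (fund(S, e_l) + F \<theta>(N e_l)). As [F^2]_{x^l} = 2 F \<theta>(N e_l), the bracket in
  \<open>spray\<close> is 4 fund(S, e_l), and the inverse matrix recovers \<open>S\<close>.\<close>

lemma spray_eq: "spray F i x y = S x y $ i"
proof -
  let ?e = "\<lambda>k::'n. axis k 1 :: real^'n"
  \<comment> \<open>Half the total derivative of [F^2]_{x^k} along \<open>d\<close>.\<close>
  define P where "P k d = dF x y d * \<theta> x y (N x y (?e k))
      + F x y * (d\<theta> x y d (N x y (?e k)) + \<theta> x y (dN x y d (?e k)))" for k d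
  have "((\<lambda>z. 2 * (F (fst z) (snd z) * \<theta> (fst z) (snd z) (N (fst z) (snd z) (?e k))))
    has_derivative (\<lambda>d. 2 * P k d)) (at (x, y))" for k
    unfolding P_def
    by (rule has_derivative_eq_rhs[OF has_derivative_mult_right[OF F\<theta>_has_derivative[OF xy N_has_derivative[OF xy]]]])
       simp
  then have dx: "((\<lambda>z. pd_x k (\<lambda>x y. (F x y)\<^sup>2) (fst z) (snd z)) has_derivative (\<lambda>d. 2 * P k d)) (at (x, y))" for k
    by (rule transform_M) (simp add: pd_F_squared)
  have "((\<lambda>z. \<Sum>k\<in>UNIV. snd z $ k * pd_x k (\<lambda>x y. (F x y)\<^sup>2) (fst z) (snd z)) has_derivative
      (\<lambda>d. \<Sum>k\<in>UNIV. y $ k * (2 * P k d) + snd d $ k * pd_x k (\<lambda>x y. (F x y)\<^sup>2) x y)) (at (x, y))"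
    by (rule has_derivative_eq_rhs, (rule has_derivative_sum has_derivative_mult dx
        bounded_linear.has_derivative[OF bounded_linear_vec_nth] snd_derivative[OF xy])+) simp
  moreover have "((\<lambda>z. \<Sum>k\<in>UNIV. snd z $ k * pd_x k (\<lambda>x y. (F x y)\<^sup>2) (fst z) (snd z)) has_derivative
      (\<lambda>d. 4 * (dF x y d * \<theta> x y (S x y) + F x y * (d\<theta> x y d (S x y) + \<theta> x y (dS x y d))))) (at (x, y))"
  proof (rule transform_M)
    show "((\<lambda>z. 4 * (F (fst z) (snd z) * \<theta> (fst z) (snd z) (S (fst z) (snd z)))) has_derivative
      (\<lambda>d. 4 * (dF x y d * \<theta> x y (S x y) + F x y * (d\<theta> x y d (S x y) + \<theta> x y (dS x y d))))) (at (x, y))"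
      by (rule has_derivative_eq_rhs[OF has_derivative_mult_right[OF F\<theta>_has_derivative[OF xy S_has_derivative[OF xy]]]])
         simp
    fix x y assume xy': "x \<in> M" "y \<noteq> (0 :: real^'n)"
    have "(\<Sum>k\<in>UNIV. y $ k * \<theta> x y (N x y (?e k))) = \<theta> x y (N x y y)"
      using linear_sum_axis[OF linear_compose[OF N_linear[OF xy'] \<theta>_linear], of y] by simp
    \<comment> \<open>By \<open>\<theta>_N\<close> this is dF(y, 0), which linearity splits into the
      spray direction, where dF vanishes, and a vertical rest.\<close>
    also have "\<dots> = dF x y (y, - (2 *\<^sub>R S x y)) - dF x y (0, - (2 *\<^sub>R S x y))"
      using linear_add[OF dF_linear[OF xy'], of "(y, 0)" "(0, - (2 *\<^sub>R S x y))"]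
      by (simp add: \<theta>_N[OF xy'])
    also have "\<dots> = 2 * \<theta> x y (S x y)"
      by (simp add: dF_spray[OF xy'] dF_y linear_neg[OF \<theta>_linear] linear_scale[OF \<theta>_linear])
    finally have "(\<Sum>k\<in>UNIV. y $ k * (2 * (F x y * \<theta> x y (N x y (?e k))))) = 4 * (F x y * \<theta> x y (S x y))"
      by (simp add: mult.assoc mult.left_commute[of "_ $ _"] flip: sum_distrib_left)
    then show "4 * (F (fst (x, y)) (snd (x, y)) * \<theta> (fst (x, y)) (snd (x, y)) (S (fst (x, y)) (snd (x, y))))
      = (\<Sum>k\<in>UNIV. snd (x, y) $ k * pd_x k (\<lambda>x y. (F x y)\<^sup>2) (fst (x, y)) (snd (x, y)))"
      by (simp add: pd_F_squared[OF xy'])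
  qed
  ultimately have "(\<lambda>d. \<Sum>k\<in>UNIV. y $ k * (2 * P k d) + snd d $ k * pd_x k (\<lambda>x y. (F x y)\<^sup>2) x y)
    = (\<lambda>d. 4 * (dF x y d * \<theta> x y (S x y) + F x y * (d\<theta> x y d (S x y) + \<theta> x y (dS x y d))))"
    by (rule has_derivative_unique)
  then have "(\<Sum>k\<in>UNIV. y $ k * (2 * P k (0, ?e l)) + ?e l $ k * pd_x k (\<lambda>x y. (F x y)\<^sup>2) x y)
      = 4 * (fund x y (S x y) (?e l) + F x y * \<theta> x y (N x y (?e l)))" for l
    by (auto dest!: fun_cong[where x = "(0, ?e l)"] simp: fund_eq[OF xy] dS_y[OF xy] distrib_left)
  moreover have "(\<Sum>k\<in>UNIV. ?e l $ k * c k) = c l" for c l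
    using inner_axis'[of l 1 "\<chi> k. c k"] by (simp add: inner_vec_def)
  ultimately have "(\<Sum>k\<in>UNIV. y $ k * (2 * P k (0, ?e l))) + pd_x l (\<lambda>x y. (F x y)\<^sup>2) x y
      = 4 * (fund x y (S x y) (?e l) + F x y * \<theta> x y (N x y (?e l)))" for l
    by (simp add: sum.distrib)
  then have "(\<Sum>k\<in>UNIV. y $ k * (2 * P k (0, ?e l))) - pd_x l (\<lambda>x y. (F x y)\<^sup>2) x y
      = 4 * fund x y (S x y) (?e l)" for l
    by (simp add: pd_F_squared[OF xy] algebra_simps)
  moreover have "pd_y l (pd_x k (\<lambda>x y. (F x y)\<^sup>2)) x y = 2 * P k (0, ?e l)" for k l
    using pd_y_eq[OF dx] .
  moreover have "(fundamental_tensor F x y *v S x y) $ l = fund x y (S x y) (?e l)" for l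
    using fundamental_tensor_mult[of "?e l" "S x y"] by (simp add: inner_axis' fund_sym)
  ultimately have "spray F i x y = (matrix_inv (fundamental_tensor F x y) *v (fundamental_tensor F x y *v S x y)) $ i"
    by (simp add: spray_def matrix_vector_mult_def[of "matrix_inv _"] mult.commute[of _ "y $ _"]
        sum_distrib_left)
  also have "\<dots> = S x y $ i"
    by (subst matrix_inv_mult_vector) (simp_all add: fundamental_tensor_mult fund_pos[OF xy])
  finally show ?thesis .
qed

end

section \<open>Riemann tensor and Ricci curvature of F\<close>

context
  fixes x y :: "real^'n"
  assumes xy: "x \<in> M" "y \<noteq> 0"
begin

lemma spray_has_derivative:
  "((\<lambda>z. spray F i (fst z) (snd z)) has_derivative (\<lambda>d. dS x y d $ i)) (at (x, y))"
  by (rule transform_M[OF xy bounded_linear.has_derivative[OF bounded_linear_vec_nth S_has_derivative[OF xy]]])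
     (simp add: spray_eq)

lemma pd_spray:
  "pd_x k (spray F i) x y = dS x y (axis k 1, 0) $ i"
  "pd_y k (spray F i) x y = N x y (axis k 1) $ i"
  using pd_x_eq[OF spray_has_derivative] pd_y_eq[OF spray_has_derivative]
  by (simp_all add: dS_y[OF xy])

end

context
  fixes x y :: "real^'n"
  assumes xy: "x \<in> M" "y \<noteq> 0"
begin

text \<open>The second and third terms of \<open>riemann\<close> are minus the derivative of
  \<open>N\<close> along (y, -2S), and the last is minus \<open>N\<close> applied twice, which is
  the left side of \<open>curvature_identity\<close>.\<close>

lemma riemann_nth: "riemann F x y $ i $ k = jacobi x (vel x y) (axis k 1 - \<theta> x y (axis k 1) *\<^sub>R A x) $ i"
proof -
  let ?e = "\<lambda>k::'n. axis k 1 :: real^'n"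
  have dN: "((\<lambda>z. pd_y k (spray F i) (fst z) (snd z)) has_derivative (\<lambda>d. dN x y d (?e k) $ i)) (at (x, y))"
    by (rule transform_M[OF xy bounded_linear.has_derivative[OF bounded_linear_vec_nth N_has_derivative[OF xy]]])
       (simp add: pd_spray)
  have lin: "linear (\<lambda>d. dN x y d (?e k) $ i)"
    using has_derivative_linear[OF dN] .
  have px: "pd_x j (pd_y k (spray F i)) x y = dN x y (?e j, 0) (?e k) $ i"
    and py: "pd_y j (pd_y k (spray F i)) x y = dN x y (0, ?e j) (?e k) $ i" for j
    using pd_x_eq[OF dN] pd_y_eq[OF dN] by simp_all
  have l1: "linear (\<lambda>w. dN x y (w, 0) (?e k) $ i)" and l2: "linear (\<lambda>w. dN x y (0, w) (?e k) $ i)"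
    using linear_add[OF lin, of "(_, 0)" "(_, 0)"] linear_scale[OF lin, of _ "(_, 0)"]
      linear_add[OF lin, of "(0, _)" "(0, _)"] linear_scale[OF lin, of _ "(0, _)"]
    by (auto intro!: linearI)
  have "(\<Sum>j\<in>UNIV. y $ j * pd_x j (pd_y k (spray F i)) x y) = dN x y (y, 0) (?e k) $ i"
    using linear_sum_axis[OF l1, of y] by (simp add: px)
  moreover have "(\<Sum>j\<in>UNIV. spray F j x y * pd_y j (pd_y k (spray F i)) x y) = dN x y (0, S x y) (?e k) $ i"
    using linear_sum_axis[OF l2, of "S x y"] by (simp add: py spray_eq[OF xy])
  moreover have "(\<Sum>j\<in>UNIV. pd_y j (spray F i) x y * pd_y k (spray F j) x y) = N x y (N x y (?e k)) $ i"
    using linear_sum_axis[OF linear_compose[OF N_linear[OF xy] bounded_linear.linear[OF bounded_linear_vec_nth]], of "N x y (?e k)" i]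
    by (simp add: pd_spray[OF xy] mult.commute)
  moreover have "dN x y (y, - (2 *\<^sub>R S x y)) (?e k) $ i = dN x y (y, 0) (?e k) $ i - 2 * dN x y (0, S x y) (?e k) $ i"
    using linear_diff[OF lin, of "(y, 0)" "2 *\<^sub>R (0, S x y)"] linear_scale[OF lin, of 2 "(0, S x y)"] by simp
  ultimately show ?thesis
    using arg_cong[OF curvature_identity[OF xy, of "?e k"], of "\<lambda>v. v $ i"]
    by (simp add: riemann_def pd_spray[OF xy])
qed

lemma jacobi_linear: "linear (jacobi x v)"
  unfolding jacobi_def
  by (auto intro!: linearI simp: bilin_simps dlin_simps bilinear_radd[OF d\<Gamma>_bilinear]
        bilinear_rmul[OF d\<Gamma>_bilinear] algebra_simps)

lemma riemann_mult: "riemann F x y *v u = jacobi x (vel x y) (u - \<theta> x y u *\<^sub>R A x)"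
proof -
  have "linear (\<lambda>u. jacobi x (vel x y) (u - \<theta> x y u *\<^sub>R A x) $ i)" for i
    by (auto intro!: linearI simp: linear_add[OF jacobi_linear] linear_diff[OF jacobi_linear]
        linear_scale[OF jacobi_linear] linear_add[OF \<theta>_linear] linear_scale[OF \<theta>_linear] algebra_simps)
  from linear_sum_axis[OF this, of u] show ?thesis
    by (simp add: vec_eq_iff matrix_vector_mult_def riemann_nth mult.commute)
qed

text \<open>The rank-one correction u \<mapsto> \<theta>(u) R_v(A x) has trace \<theta>(R_v(A
  x)).\<close>

lemma ricci_eq:
  "ricci F x y = (\<Sum>k\<in>UNIV. jacobi x (vel x y) (axis k 1) $ k)
    - g x (vel x y) (jacobi x (vel x y) (A x)) / lam x y"
proof -
  have "(\<Sum>k\<in>UNIV. \<theta> x y (axis k 1) * jacobi x (vel x y) (A x) $ k) = \<theta> x y (jacobi x (vel x y) (A x))"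
    using linear_sum_axis[OF \<theta>_linear, of "jacobi x (vel x y) (A x)" x y] by (simp add: mult.commute)
  then show ?thesis
    by (simp add: ricci_def trace_def riemann_nth linear_diff[OF jacobi_linear] linear_scale[OF jacobi_linear]
        sum_subtractf \<theta>_def)
qed

end

theorem finsler_metric:
  assumes "smooth_on (\<lambda>(x, y). F x y) (M \<times> (- {0}))"
  shows "finsler_metric_on M F"
  unfolding finsler_metric_on_def
  using assms open_M F_homogeneous F_pos fund_pos by (simp add: fundamental_tensor_mult)

end


section \<open>The Taub-NUT metric\<close>

text \<open>The form \<omega> at \<open>x\<close> is v \<mapsto> J x \<bullet> v, and as a linear
  map \<open>J\<close> is an orthogonal complex structure.\<close>

abbreviation J :: "real^4 \<Rightarrow> real^4"
  where "J \<equiv> taub_nut_form"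

lemma J_linear: "linear J"
  by (intro linearI) (simp_all add: taub_nut_form_def vec_eq_iff forall_4 algebra_simps)

lemma rotation_field_linear: "linear (rotation_field s)"
  by (intro linearI) (simp_all add: rotation_field_def vec_eq_iff forall_4 algebra_simps)

lemmas J_simps = linear_add[OF J_linear] linear_diff[OF J_linear] linear_scale[OF J_linear]
  linear_neg[OF J_linear] linear_0[OF J_linear]

lemma J_J [simp]: "J (J x) = - x"
  by (simp add: taub_nut_form_def vec_eq_iff forall_4)

lemma J_skew: "x \<bullet> J y = - (J x \<bullet> y)"
  by (simp add: taub_nut_form_def inner_vec_def sum_4)

lemma J_inner_self [simp]: "J x \<bullet> x = 0"
  using J_skew[of x x] by (simp add: inner_commute)

lemma J_anti: "J x \<bullet> y = - (J y \<bullet> x)"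
  using J_skew[of x y] by (simp add: inner_commute)

lemma J_inner_J [simp]: "J x \<bullet> J y = x \<bullet> y"
  by (simp add: J_skew)

lemma rotation_field_skew: "x \<bullet> rotation_field s y = - (rotation_field s x \<bullet> y)"
  by (simp add: rotation_field_def inner_vec_def sum_4 algebra_simps)

lemma rotation_field_inner_self [simp]: "rotation_field s x \<bullet> x = 0"
  using rotation_field_skew[of x s x] by (simp add: inner_commute)

text \<open>Together with skewness this says that the flow preserves |x| and \<omega>, hence the
  metric and its connection: the source of \<open>tn_killing\<close> and
  \<open>tn_affine\<close>.\<close>

lemma J_rotation_field: "J (rotation_field s x) = rotation_field s (J x)"
  by (simp add: rotation_field_def taub_nut_form_def vec_eq_iff forall_4)

text \<open>The expansion of \<open>w\<close> in the complex basis \<open>x, v\<close> of \<open>(\<real>\<^sup>4, J)\<close>, by Cramer's rule.\<close>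

lemma complex_expansion:
  "((x \<bullet> x) * (v \<bullet> v) - (x \<bullet> v)\<^sup>2 - (J x \<bullet> v)\<^sup>2) *\<^sub>R w
    = ((x \<bullet> w) * (v \<bullet> v) - (x \<bullet> v) * (v \<bullet> w) + (J x \<bullet> v) * (J v \<bullet> w)) *\<^sub>R x
      + ((J x \<bullet> w) * (v \<bullet> v) - (x \<bullet> v) * (J v \<bullet> w) - (J x \<bullet> v) * (v \<bullet> w)) *\<^sub>R J x
      + ((x \<bullet> x) * (v \<bullet> w) - (x \<bullet> v) * (x \<bullet> w) - (J x \<bullet> v) * (J x \<bullet> w)) *\<^sub>R v
      + ((x \<bullet> x) * (J v \<bullet> w) - (x \<bullet> v) * (J x \<bullet> w) + (J x \<bullet> v) * (x \<bullet> w)) *\<^sub>R J v"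
  by (simp add: vec_eq_iff forall_4 inner_vec_def sum_4 taub_nut_form_def, intro conjI; algebra)

section \<open>Connection of the Taub-NUT metric\<close>

definition tn_f :: "real \<Rightarrow> real^4 \<Rightarrow> real"
  where "tn_f a x = a * (x \<bullet> x) + 1"

text \<open>With names for 1/f and a/f all coefficients are polynomials, and derivatives of
  \<open>tn_i\<close> and \<open>tn_e\<close> stay polynomial in them.\<close>

definition tn_i :: "real \<Rightarrow> real^4 \<Rightarrow> real"
  where "tn_i a x = inverse (tn_f a x)"

definition tn_dG :: "real \<Rightarrow> real^4 \<Rightarrow> real^4 \<Rightarrow> real^4 \<Rightarrow> real^4 \<Rightarrow> real"
  where "tn_dG a x \<xi> v w = 2 * a * (x \<bullet> \<xi>) * (v \<bullet> w)
    + 2 * a\<^sup>2 * (x \<bullet> \<xi>) * (tn_i a x)\<^sup>2 * ((J x \<bullet> v) * (J x \<bullet> w))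
    - a * (1 + tn_i a x) * ((J \<xi> \<bullet> v) * (J x \<bullet> w) + (J x \<bullet> v) * (J \<xi> \<bullet> w))"

definition tn_e :: "real \<Rightarrow> real^4 \<Rightarrow> real"
  where "tn_e a x = a * tn_i a x"

text \<open>The Levi-Civita connection of \<open>taub_nut a\<close>, characterized by
  \<open>tn_\<Gamma>_sym\<close> and \<open>tn_compatible\<close>.\<close>

definition tn_\<Gamma> :: "real \<Rightarrow> real^4 \<Rightarrow> real^4 \<Rightarrow> real^4 \<Rightarrow> real^4"
  where "tn_\<Gamma> a x v w = tn_e a x *\<^sub>R ((x \<bullet> v) *\<^sub>R w + (x \<bullet> w) *\<^sub>R v)
    - (tn_e a x * (v \<bullet> w) + (tn_e a x)\<^sup>2 * tn_i a x * ((J x \<bullet> v) * (J x \<bullet> w))) *\<^sub>R x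
    - (tn_e a x * (1 + tn_i a x)) *\<^sub>R ((J x \<bullet> v) *\<^sub>R J w + (J x \<bullet> w) *\<^sub>R J v)
    - ((tn_e a x)\<^sup>2 * ((J x \<bullet> v) * (x \<bullet> w) + (J x \<bullet> w) * (x \<bullet> v))) *\<^sub>R J x"

text \<open>The last bracket collects the derivatives of the scalar coefficients; its factors 3, 1 +
  2 \<open>tn_i\<close> and 2 come from the degrees in 1/f.\<close>

definition tn_d\<Gamma> :: "real \<Rightarrow> real^4 \<Rightarrow> real^4 \<Rightarrow> real^4 \<Rightarrow> real^4 \<Rightarrow> real^4"
  where "tn_d\<Gamma> a x \<xi> v w =
    tn_e a x *\<^sub>R ((\<xi> \<bullet> v) *\<^sub>R w + (\<xi> \<bullet> w) *\<^sub>R v)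
    - (tn_e a x * (v \<bullet> w) + (tn_e a x)\<^sup>2 * tn_i a x * ((J x \<bullet> v) * (J x \<bullet> w))) *\<^sub>R \<xi>
    - ((tn_e a x)\<^sup>2 * tn_i a x * ((J \<xi> \<bullet> v) * (J x \<bullet> w) + (J x \<bullet> v) * (J \<xi> \<bullet> w))) *\<^sub>R x
    - (tn_e a x * (1 + tn_i a x)) *\<^sub>R ((J \<xi> \<bullet> v) *\<^sub>R J w + (J \<xi> \<bullet> w) *\<^sub>R J v)
    - ((tn_e a x)\<^sup>2 * ((J \<xi> \<bullet> v) * (x \<bullet> w) + (J \<xi> \<bullet> w) * (x \<bullet> v)
        + (J x \<bullet> v) * (\<xi> \<bullet> w) + (J x \<bullet> w) * (\<xi> \<bullet> v))) *\<^sub>R J x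
    - ((tn_e a x)\<^sup>2 * ((J x \<bullet> v) * (x \<bullet> w) + (J x \<bullet> w) * (x \<bullet> v))) *\<^sub>R J \<xi>
    - (2 * (x \<bullet> \<xi>) * (tn_e a x)\<^sup>2) *\<^sub>R (
      (x \<bullet> v) *\<^sub>R w + (x \<bullet> w) *\<^sub>R v
      - (v \<bullet> w + 3 * tn_e a x * tn_i a x * ((J x \<bullet> v) * (J x \<bullet> w))) *\<^sub>R x
      - (1 + 2 * tn_i a x) *\<^sub>R ((J x \<bullet> v) *\<^sub>R J w + (J x \<bullet> w) *\<^sub>R J v)
      - (2 * tn_e a x * ((J x \<bullet> v) * (x \<bullet> w) + (J x \<bullet> w) * (x \<bullet> v))) *\<^sub>R J x)"

text \<open>
  The almost complex structure \<open>tn_K a x\<close> is orthogonal for \<open>g\<^sub>a\<close> and defines the orientation opposite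
  to the hyperkaehler one; the curvature of \<open>g\<^sub>a\<close> is expressed by it alone.
\<close>

definition tn_K :: "real \<Rightarrow> real^4 \<Rightarrow> real^4 \<Rightarrow> real^4"
  where "tn_K a x v = J v + (a * (x \<bullet> v)) *\<^sub>R J x + (tn_e a x * (J x \<bullet> v)) *\<^sub>R x"

context
  fixes a :: real
  assumes a: "a > 0"
begin

lemma tn_f_pos: "tn_f a x > 0"
  using a by (simp add: tn_f_def add_nonneg_pos)

lemma tn_f_neq_0 [simp]: "tn_f a x \<noteq> 0"
  using tn_f_pos[of x] by simp

lemma tn_f_i: "tn_f a x * tn_i a x = 1"
  by (simp add: tn_i_def)

text \<open>Eliminates \<open>tn_i\<close> in favour of \<open>tn_e\<close> and x \<bullet> x, so
  that \<open>tn_jacobi_aux\<close> becomes a polynomial identity without side relations.\<close>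

lemma tn_i_eq: "tn_i a x = 1 - tn_e a x * (x \<bullet> x)"
  using tn_f_i[of x] by (simp add: tn_e_def tn_f_def algebra_simps)

lemma tn_f_inner: "a * (x \<bullet> x) = tn_f a x - 1"
  by (simp add: tn_f_def)

lemma taub_nut_inner:
  "v \<bullet> (taub_nut a x *v w) = tn_f a x * (v \<bullet> w) - a * (1 + tn_i a x) * ((J x \<bullet> v) * (J x \<bullet> w))"
proof -
  define c where "c = a * (1 + tn_i a x)"
  have "a * (a * (norm x)\<^sup>2 + 2) / (a * (norm x)\<^sup>2 + 1) = a * (tn_f a x + 1) / tn_f a x"
    by (simp add: tn_f_def power2_norm_eq_inner)
  also have "\<dots> = c"
    by (simp add: c_def tn_i_def field_simps)
  finally have "taub_nut a x $ i $ j = tn_f a x * (if i = j then 1 else 0) - c * (J x $ i * J x $ j)" for i j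
    by (simp add: taub_nut_def tn_f_def power2_norm_eq_inner)
  then have "v \<bullet> (taub_nut a x *v w) = tn_f a x * (v \<bullet> w) - c * ((J x \<bullet> v) * (J x \<bullet> w))"
    by (simp add: inner_vec_def matrix_vector_mult_def sum_4) (simp add: algebra_simps)
  then show ?thesis by (simp add: c_def)
qed

lemma tn_f_has_derivative [derivative_intros]:
  "(X has_derivative X') (at z) \<Longrightarrow>
    ((\<lambda>z. tn_f a (X z)) has_derivative (\<lambda>d. 2 * a * (X z \<bullet> X' d))) (at z)"
  unfolding tn_f_def by (auto intro!: derivative_eq_intros simp: inner_commute algebra_simps)

lemma tn_i_has_derivative [derivative_intros]:
  "(X has_derivative X') (at z) \<Longrightarrow>
    ((\<lambda>z. tn_i a (X z)) has_derivative (\<lambda>d. - (2 * (X z \<bullet> X' d) * tn_e a (X z) * tn_i a (X z)))) (at z)"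
  unfolding tn_e_def tn_i_def by (auto intro!: derivative_eq_intros simp: algebra_simps)

lemma tn_e_has_derivative [derivative_intros]:
  "(X has_derivative X') (at z) \<Longrightarrow>
    ((\<lambda>z. tn_e a (X z)) has_derivative (\<lambda>d. - (2 * (X z \<bullet> X' d) * (tn_e a (X z))\<^sup>2))) (at z)"
  unfolding tn_e_def by (auto intro!: derivative_eq_intros simp: power2_eq_square tn_e_def algebra_simps)

lemma J_has_derivative [derivative_intros]:
  "(X has_derivative X') (at z) \<Longrightarrow> ((\<lambda>z. J (X z)) has_derivative (\<lambda>d. J (X' d))) (at z)"
  using J_linear linear_conv_bounded_linear bounded_linear.has_derivative by blast

text \<open>By Cauchy-Schwarz the form is at least (f - (1 + 1/f)(f - 1)) |v|^2 = |v|^2 / f.\<close>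

lemma taub_nut_pos:
  assumes "v \<noteq> 0"
  shows "v \<bullet> (taub_nut a x *v v) > 0"
proof -
  have i: "tn_i a x > 0"
    using tn_f_pos by (simp add: tn_i_def)
  have "(J x \<bullet> v) * (J x \<bullet> v) \<le> (x \<bullet> x) * (v \<bullet> v)"
    using Cauchy_Schwarz_ineq[of "J x" v] by (simp add: power2_eq_square)
  then have "a * (1 + tn_i a x) * ((J x \<bullet> v) * (J x \<bullet> v)) \<le> a * (1 + tn_i a x) * ((x \<bullet> x) * (v \<bullet> v))"
    using a i by (intro mult_left_mono) auto
  also have "\<dots> = (1 + tn_i a x) * (tn_f a x - 1) * (v \<bullet> v)"
    by (simp flip: tn_f_inner)
  also have "(1 + tn_i a x) * (tn_f a x - 1) = tn_f a x - tn_i a x"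
    using tn_f_i[of x] by (simp add: algebra_simps)
  also have "(tn_f a x - tn_i a x) * (v \<bullet> v) < tn_f a x * (v \<bullet> v)"
    using assms i by simp
  finally show ?thesis by (simp add: taub_nut_inner)
qed

lemma taub_nut_has_derivative:
  "((\<lambda>x. v \<bullet> (taub_nut a x *v w)) has_derivative (\<lambda>\<xi>. tn_dG a x \<xi> v w)) (at x)"
  unfolding taub_nut_inner tn_dG_def
  by (auto intro!: derivative_eq_intros simp: tn_e_def fun_eq_iff algebra_simps power2_eq_square)

lemma tn_\<Gamma>_has_derivative:
  "((\<lambda>x. tn_\<Gamma> a x v w) has_derivative (\<lambda>\<xi>. tn_d\<Gamma> a x \<xi> v w)) (at x)"
  unfolding tn_\<Gamma>_def tn_d\<Gamma>_def
  by (rule has_derivative_eq_rhs, (rule derivative_intros)+)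
    (simp add: fun_eq_iff vec_eq_iff algebra_simps power2_eq_square)

lemma tn_compatible:
  "tn_dG a x \<xi> v w = tn_\<Gamma> a x \<xi> v \<bullet> (taub_nut a x *v w) + v \<bullet> (taub_nut a x *v tn_\<Gamma> a x \<xi> w)"
proof -
  \<comment> \<open>Orients every inner product one way, so that equal scalars coincide; the rest
    holds modulo a |x|^2 = f - 1 and f \<open>tn_i\<close> = 1.\<close>
  note c = inner_commute[of v x] inner_commute[of w x] inner_commute[of \<xi> x]
    inner_commute[of v \<xi>] inner_commute[of w \<xi>] inner_commute[of w v]
    J_anti[of v x] J_anti[of w x] J_anti[of \<xi> x] J_anti[of v \<xi>] J_anti[of w \<xi>] J_anti[of w v]
  show ?thesis
    unfolding taub_nut_inner tn_dG_def tn_\<Gamma>_def tn_e_def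
    by (simp add: inner_simps J_skew c) (use tn_f_inner[of x] tn_f_i[of x] in algebra)
qed

lemma tn_dG_bilinear: "bilinear (tn_dG a x \<xi>)"
  unfolding bilinear_def tn_dG_def
  by (auto intro!: linearI simp: inner_simps algebra_simps add_divide_distrib)

lemma tn_\<Gamma>_bilinear: "bilinear (tn_\<Gamma> a x)"
  unfolding bilinear_def tn_\<Gamma>_def
  by (auto intro!: linearI simp: inner_simps J_simps algebra_simps)

lemma tn_d\<Gamma>_bilinear: "bilinear (tn_d\<Gamma> a x \<xi>)"
  unfolding bilinear_def tn_d\<Gamma>_def
  by (auto intro!: linearI simp: inner_simps J_simps algebra_simps)

lemma tn_\<Gamma>_sym: "tn_\<Gamma> a x v w = tn_\<Gamma> a x w v"
  by (simp add: tn_\<Gamma>_def inner_commute[of v w] add.commute mult.commute)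

lemma tn_killing:
  "tn_dG a x (rotation_field s x) v w + rotation_field s v \<bullet> (taub_nut a x *v w)
    + v \<bullet> (taub_nut a x *v rotation_field s w) = 0"
  unfolding taub_nut_inner tn_dG_def
  by (simp add: J_rotation_field rotation_field_skew algebra_simps)

lemma tn_affine:
  "tn_d\<Gamma> a x (rotation_field s x) v w = rotation_field s (tn_\<Gamma> a x v w)
    - tn_\<Gamma> a x (rotation_field s v) w - tn_\<Gamma> a x v (rotation_field s w)"
  unfolding tn_\<Gamma>_def tn_d\<Gamma>_def
  by (simp add: J_rotation_field rotation_field_skew linear_add[OF rotation_field_linear]
      linear_diff[OF rotation_field_linear] linear_scale[OF rotation_field_linear] algebra_simps)

section \<open>Curvature of the Taub-NUT metric\<close>

lemma tn_K_g: "tn_K a x v \<bullet> (taub_nut a x *v w)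
    = tn_f a x * (J v \<bullet> w) + a * ((J x \<bullet> v) * (x \<bullet> w) - (x \<bullet> v) * (J x \<bullet> w))"
  unfolding taub_nut_inner tn_K_def tn_e_def
  by (simp add: inner_simps) (use tn_f_inner[of x] tn_f_i[of x] in algebra)

lemma tn_K_g_self: "tn_K a x v \<bullet> (taub_nut a x *v v) = 0"
  by (simp add: tn_K_g)

lemma tn_K_g_K: "tn_K a x v \<bullet> (taub_nut a x *v tn_K a x v) = v \<bullet> (taub_nut a x *v v)"
  unfolding tn_K_g unfolding tn_K_def taub_nut_inner tn_e_def
  by (simp add: inner_simps J_skew inner_commute[of v x] J_anti[of v x])
    (use tn_f_inner[of x] tn_f_i[of x] in algebra)

text \<open>The right side is that of \<open>tn_jacobi\<close>, rewritten in \<open>tn_e\<close> and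
  \<open>tn_i\<close>. With the inner products as independent variables the two sides differ by a
  multiple of the relation \<open>complex_expansion\<close>, which holds because the complex
  dimension is two.\<close>

lemma tn_jacobi_aux:
  "tn_d\<Gamma> a x w v v - tn_d\<Gamma> a x v v w + tn_\<Gamma> a x (tn_\<Gamma> a x v v) w - tn_\<Gamma> a x v (tn_\<Gamma> a x v w)
    = - 2 *\<^sub>R (
      (tn_e a x * tn_i a x * (v \<bullet> v) - (tn_e a x)\<^sup>2 * tn_i a x * (1 + tn_i a x) * (J x \<bullet> v)\<^sup>2) *\<^sub>R w
      - (tn_e a x * tn_i a x * (v \<bullet> w)
         - (tn_e a x)\<^sup>2 * tn_i a x * (1 + tn_i a x) * ((J x \<bullet> v) * (J x \<bullet> w))) *\<^sub>R v
      - (3 * (tn_e a x * (J v \<bullet> w) + (tn_e a x)\<^sup>2 * ((J x \<bullet> v) * (x \<bullet> w) - (x \<bullet> v) * (J x \<bullet> w)))) *\<^sub>R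
        (tn_i a x *\<^sub>R J v + (tn_e a x * (x \<bullet> v)) *\<^sub>R J x + (tn_i a x * tn_e a x * (J x \<bullet> v)) *\<^sub>R x))"
  (is "?l = ?r")
proof -
  have "?l \<bullet> z = ?r \<bullet> z" for z
  proof -
    note c = inner_commute[of v x] inner_commute[of w x] inner_commute[of z x]
      inner_commute[of v z] inner_commute[of w z] inner_commute[of w v]
      J_anti[of v x] J_anti[of w x] J_anti[of z x] J_anti[of v z] J_anti[of w z] J_anti[of w v]
    define D where "D = ((x \<bullet> x) * (v \<bullet> v) - (x \<bullet> v)\<^sup>2 - (J x \<bullet> v)\<^sup>2) *\<^sub>R w
      - (((x \<bullet> w) * (v \<bullet> v) - (x \<bullet> v) * (v \<bullet> w) + (J x \<bullet> v) * (J v \<bullet> w)) *\<^sub>R x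
        + ((J x \<bullet> w) * (v \<bullet> v) - (x \<bullet> v) * (J v \<bullet> w) - (J x \<bullet> v) * (v \<bullet> w)) *\<^sub>R J x
        + ((x \<bullet> x) * (v \<bullet> w) - (x \<bullet> v) * (x \<bullet> w) - (J x \<bullet> v) * (J x \<bullet> w)) *\<^sub>R v
        + ((x \<bullet> x) * (J v \<bullet> w) - (x \<bullet> v) * (J x \<bullet> w) + (J x \<bullet> v) * (x \<bullet> w)) *\<^sub>R J v)"
    \<comment> \<open>Pairing with an arbitrary \<open>z\<close> makes the claim scalar;
      \<open>D\<close> carries the defect, with coefficient -3 \<open>tn_e\<close>^2.\<close>
    have "?l \<bullet> z = ?r \<bullet> z - 3 * (tn_e a x)\<^sup>2 * (D \<bullet> z)"
      unfolding tn_d\<Gamma>_def tn_\<Gamma>_def D_def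
      by (simp only: inner_simps J_simps J_skew c J_J J_inner_J J_inner_self inner_minus_left
          inner_minus_right, simp only: tn_i_eq) algebra
    moreover have "D = 0"
      by (simp add: D_def complex_expansion)
    ultimately show ?thesis by simp
  qed
  then show ?thesis by (metis vector_eq_rdot)
qed

lemma tn_jacobi:
  "tn_d\<Gamma> a x w v v - tn_d\<Gamma> a x v v w + tn_\<Gamma> a x (tn_\<Gamma> a x v v) w - tn_\<Gamma> a x v (tn_\<Gamma> a x v w)
    = (- 2 * a * tn_i a x ^ 3) *\<^sub>R ((v \<bullet> (taub_nut a x *v v)) *\<^sub>R w - (v \<bullet> (taub_nut a x *v w)) *\<^sub>R v
        - (3 * (tn_K a x v \<bullet> (taub_nut a x *v w))) *\<^sub>R tn_K a x v)"
  unfolding tn_jacobi_aux tn_K_g unfolding taub_nut_inner tn_K_def tn_e_def vec_eq_iff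
  by simp (use tn_f_i[of x] in algebra)

end

section \<open>The Randers metric on the navigation domain\<close>

lemma nav_domain_eq:
  "nav_domain a s = {x. rotation_field s x \<bullet> (taub_nut a x *v rotation_field s x) < 1}"
proof -
  have "field_norm (taub_nut a) (rotation_field s) x
      = sqrt (rotation_field s x \<bullet> (taub_nut a x *v rotation_field s x))" for x
    by (simp add: field_norm_def lower_def matrix_vector_mult_def inner_vec_def mult.commute)
  then show ?thesis by (simp add: nav_domain_def)
qed

context
  fixes a s :: real
  assumes a: "a > 0"
begin

lemma taub_nut_sym: "v \<bullet> (taub_nut a x *v w) = w \<bullet> (taub_nut a x *v v)"
  unfolding taub_nut_inner[OF a] inner_commute[of w v] by simp

lemma killing_navigation_taub_nut:
  "killing_navigation (taub_nut a) (tn_dG a) (tn_\<Gamma> a) (tn_d\<Gamma> a) (rotation_field s)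
    (nav_randers (taub_nut a) (rotation_field s))"
  using a
  by unfold_locales
    (rule taub_nut_sym taub_nut_pos taub_nut_has_derivative tn_dG_bilinear tn_\<Gamma>_bilinear tn_\<Gamma>_sym
      tn_\<Gamma>_has_derivative tn_d\<Gamma>_bilinear tn_compatible linear_add[OF rotation_field_linear]
      linear_scale[OF rotation_field_linear] tn_killing tn_affine refl | assumption)+

interpretation killing_navigation "taub_nut a" "tn_dG a" "tn_\<Gamma> a" "tn_d\<Gamma> a" "rotation_field s"
  "nav_randers (taub_nut a) (rotation_field s)"
  by (rule killing_navigation_taub_nut)

lemma M_eq: "M = nav_domain a s"
  by (simp add: M_def nav_domain_eq g_def)

lemma smooth_on_taub_nut:
  fixes P Q :: "(real^4) \<times> (real^4) \<Rightarrow> real^4"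
  assumes "open U" "bounded_linear P" "bounded_linear Q"
  shows "smooth_on (\<lambda>z. g (fst z) (P z) (Q z)) U"
proof -
  have J: "bounded_linear J"
    using J_linear linear_conv_bounded_linear by blast
  have f: "smooth_on (\<lambda>z. tn_f a (fst z)) U"
    unfolding tn_f_def using assms(1)
    by (intro smooth_on_add smooth_on_mult smooth_on_const smooth_on_inner_linear bounded_linear_fst)
  have J: "bounded_linear (\<lambda>z. J (fst z))"
    using bounded_linear_compose[OF J bounded_linear_fst] .
  show ?thesis
    unfolding g_def taub_nut_inner[OF a] tn_i_def inverse_eq_divide using assms f J
    by (intro smooth_on_add smooth_on_diff smooth_on_mult smooth_on_const smooth_on_divide
        smooth_on_inner_linear) (auto simp: tn_f_neq_0[OF a])
qed

lemma smooth_on_F: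
  "smooth_on (\<lambda>(x, y). nav_randers (taub_nut a) (rotation_field s) x y) (M \<times> (- {0}))"
proof -
  let ?U = "M \<times> (- {0 :: real^4})"
  have U: "open ?U" by (rule open_M_times)
  have A: "bounded_linear (\<lambda>z :: (real^4) \<times> (real^4). rotation_field s (fst z))"
    using rotation_field_linear linear_conv_bounded_linear bounded_linear_compose bounded_linear_fst by blast
  have rad: "(1 - g (fst z) (rotation_field s (fst z)) (rotation_field s (fst z)))
      * g (fst z) (snd z) (snd z) + (g (fst z) (snd z) (rotation_field s (fst z)))\<^sup>2 > 0"
    and den: "1 - g (fst z) (rotation_field s (fst z)) (rotation_field s (fst z)) \<noteq> 0"
    if "z \<in> ?U" for z
    using that radicand_pos[of "fst z" "snd z"] by (simp_all add: mem_Times_iff M_def)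
  note g = smooth_on_taub_nut[OF U]
  have "smooth_on (\<lambda>z. (sqrt ((1 - g (fst z) (rotation_field s (fst z)) (rotation_field s (fst z)))
        * g (fst z) (snd z) (snd z) + (g (fst z) (snd z) (rotation_field s (fst z)))\<^sup>2)
      - g (fst z) (snd z) (rotation_field s (fst z)))
    / (1 - g (fst z) (rotation_field s (fst z)) (rotation_field s (fst z)))) ?U"
    using U
    by (intro smooth_on_divide smooth_on_diff smooth_on_sqrt smooth_on_add smooth_on_mult
        smooth_on_power smooth_on_const g A bounded_linear_snd rad den)
  then show ?thesis
    by (rule smooth_on_cong[OF U, rotated]) (auto simp: F_eq)
qed

lemma jacobi_eq: "jacobi x v w = (- 2 * a * tn_i a x ^ 3) *\<^sub>R
  (g x v v *\<^sub>R w - g x v w *\<^sub>R v - (3 * g x (tn_K a x v) w) *\<^sub>R tn_K a x v)"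
  unfolding jacobi_def tn_jacobi[OF a] g_def ..

lemma g_K: "g x (tn_K a x v) v = 0" "g x v (tn_K a x v) = 0" "g x (tn_K a x v) (tn_K a x v) = g x v v"
  using tn_K_g_self[OF a] tn_K_g_K[OF a] g_sym[of x v "tn_K a x v"] by (simp_all add: g_def)

text \<open>The trace of the Jacobi operator is proportional to (4 - 1 - 3) g(v, v) = 0, as
  \<open>tn_K\<close> preserves \<open>g\<close>; the correction in \<open>ricci_eq\<close> vanishes
  because g(v, R_v w) = 0.\<close>

lemma ricci_zero:
  assumes "x \<in> M" "y \<noteq> 0"
  shows "ricci (nav_randers (taub_nut a) (rotation_field s)) x y = 0"
proof -
  let ?v = "vel x y"
  have r: "linear (g x u)" for u
    using g_bilinear by (simp add: bilinear_def)
  have "g x ?v (jacobi x ?v w) = 0" for w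
    by (simp add: jacobi_eq bilin_simps g_K)
  moreover have "(\<Sum>k\<in>UNIV. jacobi x ?v (axis k 1) $ k) = 0"
  proof -
    have tr: "(\<Sum>k\<in>UNIV. g x u (axis k 1) * u' $ k) = g x u u'" for u u'
      using linear_sum_axis[OF r, of u' u] by (simp add: mult.commute)
    have "(\<Sum>k\<in>UNIV. jacobi x ?v (axis k 1) $ k) = (- 2 * a * tn_i a x ^ 3) *
      (4 * g x ?v ?v - (\<Sum>k\<in>UNIV. g x ?v (axis k 1) * ?v $ k)
        - 3 * (\<Sum>k\<in>UNIV. g x (tn_K a x ?v) (axis k 1) * tn_K a x ?v $ k))"
      by (simp add: jacobi_eq mult.assoc sum_subtractf sum_negf flip: sum_distrib_left)
    then show ?thesis by (simp add: tr g_K)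
  qed
  ultimately show ?thesis by (simp add: ricci_eq[OF assms])
qed

lemma not_constant_flag_curvature:
  "\<not> constant_flag_curvature_on (M) (nav_randers (taub_nut a) (rotation_field s))"
proof
  let ?F = "nav_randers (taub_nut a) (rotation_field s)"
  assume "constant_flag_curvature_on (M) ?F"
  then obtain c where c: "x \<in> M \<Longrightarrow> y \<noteq> 0 \<Longrightarrow> u \<notin> span {y} \<Longrightarrow> flag_curvature ?F x y u = c" for x y u
    unfolding constant_flag_curvature_on_def by blast
  have A0: "rotation_field s 0 = 0" and J0: "J 0 = 0"
    using linear_0[OF rotation_field_linear] linear_0[OF J_linear] by auto
  have f0: "tn_f a 0 = 1" "tn_i a 0 = 1"
    by (simp_all add: tn_f_def tn_i_def)
  have g0: "g 0 v w = v \<bullet> w" for v w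
    unfolding g_def taub_nut_inner[OF a] by (simp add: J0 f0)
  have M0: "0 \<in> M"
    by (simp add: M_def A0 g0)
  define y :: "real^4" where "y = axis 1 1"
  have y: "y \<noteq> 0" by (simp add: y_def axis_eq_0_iff)
  have yy: "y \<bullet> y = 1" by (simp add: y_def inner_axis_axis)
  \<comment> \<open>With F = lam, \<open>fund\<close> at the origin reduces to the Euclidean inner
    product.\<close>
  have lam: "lam 0 y = ?F 0 y"
    by (simp add: lam_def A0 g0)
  have curv: "flag_curvature ?F 0 y u = - 2 * a * (1 - 3 * (J y \<bullet> u)\<^sup>2)"
    if "y \<bullet> u = 0" "u \<bullet> u = 1" for u
  proof -
    have "u \<bullet> (fundamental_tensor ?F 0 y *v w) = u \<bullet> w" for u w
      using lam_pos[OF M0 y] by (simp add: fundamental_tensor_mult[OF M0 y] fund_def A0 g0 lam)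
    moreover have "riemann ?F 0 y *v u = (- 2 * a) *\<^sub>R (u - (3 * (J y \<bullet> u)) *\<^sub>R J y)"
      using that by (simp add: riemann_mult[OF M0 y] A0 vel_def jacobi_eq f0 g0 tn_K_def J0 yy)
    ultimately show ?thesis
      using that by (simp add: flag_curvature_def inner_simps power2_eq_square yy)
  qed
  have nin: "axis k 1 \<notin> span {y}" if "k \<noteq> 1" for k
  proof
    assume "axis k 1 \<in> span {y}"
    then obtain t where "axis k 1 = t *\<^sub>R y"
      by (auto simp: span_singleton)
    then have "(axis k 1 :: real^4) $ k = t * y $ k" by simp
    then show False using that by (simp add: y_def axis_def)
  qed
  have ax: "(axis i 1 :: real^4) $ j = (if j = i then 1 else 0)" for i j
    by (simp add: axis_def)
  \<comment> \<open>\<open>axis 2 1\<close> is J y, so the flag is a complex line;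
    \<open>axis 3 1\<close> is orthogonal to both y and J y.\<close>
  have "c = 4 * a"
    using c[OF M0 y nin[of 2]] curv[of "axis 2 1"]
    by (simp add: y_def inner_axis_axis ax inner_axis taub_nut_form_def)
  moreover have "c = - 2 * a"
    using c[OF M0 y nin[of 3]] curv[of "axis 3 1"]
    by (simp add: y_def inner_axis_axis ax inner_axis taub_nut_form_def)
  ultimately show False using a by simp
qed

text \<open>The metric is Ricci-flat, so the scalar function is 0.\<close>

lemma einstein:
  "einstein_metric_on (M) (nav_randers (taub_nut a) (rotation_field s))"
  unfolding einstein_metric_on_def
  using finsler_metric[OF smooth_on_F] ricci_zero by (intro conjI exI[of _ "\<lambda>x. 0"]) auto

end

theorem theorem3p4:
  fixes a s :: real and F :: "real^4 \<Rightarrow> real^4 \<Rightarrow> real"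
  assumes "a > 0"
    and "F = nav_randers (taub_nut a) (rotation_field s)"
  shows "einstein_metric_on (nav_domain a s) F \<and>
         \<not> constant_flag_curvature_on (nav_domain a s) F"
  using einstein[OF assms(1)] not_constant_flag_curvature[OF assms(1)]
  unfolding assms(2) M_eq[OF assms(1)] by blast

end
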